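(* Let $G$ be a connected Lie group, and let $X$ be a connected Hausdorff $G$-space equipped with a $G$-invariant probability measure $\mu$ of full support. Assume $(X,\mu)$ has the qualitative Sobolev embedding property. Then $X\cong H\backslash G$ as $G$-spaces for some closed cocompact subgroup $H\subseteq G$.
   Context: A $G$-space is a topological space $X$ with a $G$-action whose action map $G\times X\to X$ is continuous. $(X,\mu)$ has the qualitative Sobolev embedding property if there exist $1\le p<q\le\infty$ and a nonnegative continuous function $\varphi\in L^1(G)$ (with respect to a Haar measure), not identically zero, such that for every $f\in L^p(X,\mu)$ the convolution $\varphi*f(x)=\int_G\varphi(g)f(g^{-1}x)\,dg$ lies in $L^q(X,\mu)$. $H\backslash G$ carries the action of $G$ by right multiplication. *)

theory Defs
  imports "HOL-Analysis.Analysis" "HOL-Probability.Probability" "HOL-Algebra.Coset"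
begin

definition borel_of_top :: "'a topology \<Rightarrow> 'a measure" where
  "borel_of_top T = sigma (topspace T) {U. openin T U}"

fun iter_dderiv :: "'a::euclidean_space list \<Rightarrow> ('a \<Rightarrow> 'b::real_normed_vector) \<Rightarrow> 'a \<Rightarrow> 'b" where
  "iter_dderiv [] f = f"
| "iter_dderiv (v # vs) f = (\<lambda>x. frechet_derivative (iter_dderiv vs f) (at x) v)"

text \<open>C-infinity on an open set: all partial derivatives of all orders exist and are
  (differentiable, hence) continuous.\<close>
definition smooth_on :: "'a::euclidean_space set \<Rightarrow> ('a \<Rightarrow> 'b::euclidean_space) \<Rightarrow> bool" where
  "smooth_on S f \<longleftrightarrow> open S \<and> (\<forall>vs \<in> lists Basis. iter_dderiv vs f differentiable_on S)"

definition chart_on :: "'a topology \<Rightarrow> 'a set \<Rightarrow> ('a \<Rightarrow> 'n::euclidean_space) \<Rightarrow> bool" where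
  "chart_on T U \<phi> \<longleftrightarrow> openin T U \<and> open (\<phi> ` U) \<and>
     homeomorphic_map (subtopology T U) (top_of_set (\<phi> ` U)) \<phi>"

definition smooth_atlas :: "'a topology \<Rightarrow> ('a set \<times> ('a \<Rightarrow> 'n::euclidean_space)) set \<Rightarrow> bool" where
  "smooth_atlas T A \<longleftrightarrow>
     (\<forall>(U, \<phi>) \<in> A. chart_on T U \<phi>) \<and>
     (\<Union>(U, \<phi>) \<in> A. U) = topspace T \<and>
     (\<forall>(U, \<phi>) \<in> A. \<forall>(V, \<psi>) \<in> A. smooth_on (\<phi> ` (U \<inter> V)) (\<psi> \<circ> inv_into U \<phi>))"

definition smooth_map_atlas ::
  "'a topology \<Rightarrow> ('a set \<times> ('a \<Rightarrow> 'n::euclidean_space)) set \<Rightarrow>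
   'b topology \<Rightarrow> ('b set \<times> ('b \<Rightarrow> 'm::euclidean_space)) set \<Rightarrow> ('a \<Rightarrow> 'b) \<Rightarrow> bool" where
  "smooth_map_atlas T A T' B f \<longleftrightarrow> continuous_map T T' f \<and>
     (\<forall>(U, \<phi>) \<in> A. \<forall>(V, \<psi>) \<in> B.
        smooth_on (\<phi> ` (U \<inter> f -` V)) (\<psi> \<circ> f \<circ> inv_into U \<phi>))"

definition prod_atlas ::
  "('a set \<times> ('a \<Rightarrow> 'n::euclidean_space)) set \<Rightarrow> ('b set \<times> ('b \<Rightarrow> 'm::euclidean_space)) set \<Rightarrow>
   (('a \<times> 'b) set \<times> ('a \<times> 'b \<Rightarrow> 'n \<times> 'm)) set" where
  "prod_atlas A B = {(U \<times> V, \<lambda>(x, y). (\<phi> x, \<psi> y)) | U \<phi> V \<psi>. (U, \<phi>) \<in> A \<and> (V, \<psi>) \<in> B}"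

text \<open>A Lie group of dimension DIM('n), or of dimension 0 (discrete): a Hausdorff topological
  group whose topology carries a smooth atlas with values in 'n for which multiplication and
  inversion are smooth. Since the theorem is universally quantified over 'n, "G is a Lie group"
  is rendered as "lie_group G TG TYPE('n)" for a type variable 'n.\<close>
definition lie_group :: "('g, 'z) monoid_scheme \<Rightarrow> 'g topology \<Rightarrow> 'n::euclidean_space itself \<Rightarrow> bool" where
  "lie_group G TG _ \<longleftrightarrow> group G \<and> topspace TG = carrier G \<and> Hausdorff_space TG \<and>
     continuous_map (prod_topology TG TG) TG (\<lambda>(x, y). x \<otimes>\<^bsub>G\<^esub> y) \<and>
     continuous_map TG TG (\<lambda>x. inv\<^bsub>G\<^esub> x) \<and>
     ((\<forall>U. U \<subseteq> topspace TG \<longrightarrow> openin TG U) \<or>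
      (\<exists>A :: ('g set \<times> ('g \<Rightarrow> 'n)) set. smooth_atlas TG A \<and>
          smooth_map_atlas (prod_topology TG TG) (prod_atlas A A) TG A (\<lambda>(x, y). x \<otimes>\<^bsub>G\<^esub> y) \<and>
          smooth_map_atlas TG A TG A (\<lambda>x. inv\<^bsub>G\<^esub> x)))"

definition haar_measure :: "('g, 'z) monoid_scheme \<Rightarrow> 'g topology \<Rightarrow> 'g measure \<Rightarrow> bool" where
  "haar_measure G TG \<nu> \<longleftrightarrow>
     space \<nu> = topspace TG \<and> sets \<nu> = sets (borel_of_top TG) \<and>
     (\<forall>g \<in> carrier G. \<forall>A \<in> sets \<nu>. emeasure \<nu> ((\<lambda>x. g \<otimes>\<^bsub>G\<^esub> x) ` A) = emeasure \<nu> A) \<and>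
     (\<forall>K. compactin TG K \<longrightarrow> emeasure \<nu> K < \<infinity>) \<and>
     (\<forall>A \<in> sets \<nu>. emeasure \<nu> A = (INF U \<in> {U. openin TG U \<and> A \<subseteq> U}. emeasure \<nu> U)) \<and>
     (\<forall>U. openin TG U \<longrightarrow> emeasure \<nu> U = (SUP K \<in> {K. compactin TG K \<and> K \<subseteq> U}. emeasure \<nu> K)) \<and>
     emeasure \<nu> (space \<nu>) \<noteq> 0"

definition in_Lp :: "'a measure \<Rightarrow> ennreal \<Rightarrow> ('a \<Rightarrow> real) \<Rightarrow> bool" where
  "in_Lp M p f \<longleftrightarrow> f \<in> borel_measurable M \<and>
     (if p = \<infinity> then (\<exists>C. AE x in M. \<bar>f x\<bar> \<le> C)
      else (\<integral>\<^sup>+ x. ennreal (\<bar>f x\<bar> powr enn2real p) \<partial>M) < \<infinity>)"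

definition in_Lp_ae :: "'a measure \<Rightarrow> ennreal \<Rightarrow> ('a \<Rightarrow> real) \<Rightarrow> bool" where
  "in_Lp_ae M p f \<longleftrightarrow> (\<exists>h. in_Lp M p h \<and> (AE x in M. f x = h x))"

definition g_space :: "('g, 'z) monoid_scheme \<Rightarrow> 'g topology \<Rightarrow> 'x topology \<Rightarrow> ('g \<Rightarrow> 'x \<Rightarrow> 'x) \<Rightarrow> bool" where
  "g_space G TG TX act \<longleftrightarrow>
     (\<forall>x \<in> topspace TX. act \<one>\<^bsub>G\<^esub> x = x) \<and>
     (\<forall>g \<in> carrier G. \<forall>h \<in> carrier G. \<forall>x \<in> topspace TX. act (g \<otimes>\<^bsub>G\<^esub> h) x = act g (act h x)) \<and>
     continuous_map (prod_topology TG TX) TX (\<lambda>(g, x). act g x)"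

definition invariant_measure :: "('g, 'z) monoid_scheme \<Rightarrow> ('g \<Rightarrow> 'x \<Rightarrow> 'x) \<Rightarrow> 'x measure \<Rightarrow> bool" where
  "invariant_measure G act \<mu> \<longleftrightarrow>
     (\<forall>g \<in> carrier G. \<forall>A \<in> sets \<mu>. emeasure \<mu> (act g -` A \<inter> space \<mu>) = emeasure \<mu> A)"

definition full_support :: "'x topology \<Rightarrow> 'x measure \<Rightarrow> bool" where
  "full_support TX \<mu> \<longleftrightarrow> (\<forall>U. openin TX U \<and> U \<noteq> {} \<longrightarrow> emeasure \<mu> U > 0)"

definition convolution_act ::
  "('g, 'z) monoid_scheme \<Rightarrow> 'g measure \<Rightarrow> ('g \<Rightarrow> 'x \<Rightarrow> 'x) \<Rightarrow> ('g \<Rightarrow> real) \<Rightarrow> ('x \<Rightarrow> real) \<Rightarrow> 'x \<Rightarrow> real" where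
  "convolution_act G \<nu> act \<phi> f x = (\<integral> g. \<phi> g * f (act (inv\<^bsub>G\<^esub> g) x) \<partial>\<nu>)"

definition qualitative_sobolev ::
  "('g, 'z) monoid_scheme \<Rightarrow> 'g topology \<Rightarrow> ('g \<Rightarrow> 'x \<Rightarrow> 'x) \<Rightarrow> 'x measure \<Rightarrow> bool" where
  "qualitative_sobolev G TG act \<mu> \<longleftrightarrow>
     (\<exists>p q \<nu> \<phi>. 1 \<le> p \<and> p < q \<and> haar_measure G TG \<nu> \<and>
        continuous_map TG euclideanreal \<phi> \<and> (\<forall>g \<in> carrier G. 0 \<le> \<phi> g) \<and>
        in_Lp \<nu> 1 \<phi> \<and> (\<exists>g \<in> carrier G. \<phi> g \<noteq> 0) \<and>
        (\<forall>f. in_Lp \<mu> p f \<longrightarrow> in_Lp_ae \<mu> q (convolution_act G \<nu> act \<phi> f)))"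

definition coset_topology :: "('g, 'z) monoid_scheme \<Rightarrow> 'g topology \<Rightarrow> 'g set \<Rightarrow> 'g set topology" where
  "coset_topology G TG H = topology (\<lambda>U. U \<subseteq> rcosets\<^bsub>G\<^esub> H \<and> openin TG (\<Union>U))"

text \<open>G acts on H\G by right multiplication; as a left action, g sends H y to H y g^{-1}.\<close>
definition coset_space_iso ::
  "('g, 'z) monoid_scheme \<Rightarrow> 'g topology \<Rightarrow> 'x topology \<Rightarrow> ('g \<Rightarrow> 'x \<Rightarrow> 'x) \<Rightarrow> 'g set \<Rightarrow> bool" where
  "coset_space_iso G TG TX act H \<longleftrightarrow>
     (\<exists>\<Phi>. homeomorphic_map TX (coset_topology G TG H) \<Phi> \<and>
        (\<forall>g \<in> carrier G. \<forall>x \<in> topspace TX. \<Phi> (act g x) = \<Phi> x #>\<^bsub>G\<^esub> inv\<^bsub>G\<^esub> g))"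

end

theory Submission
  imports Defs
begin

text \<open>
  Testing the Sobolev embedding on a function built from indicators shows that a fixed neighbourhood
  \<open>B\<close> of the identity expands small open sets: \<open>\<mu> E powr r \<le> C * \<mu> (B E)\<close> with \<open>r = p / q < 1\<close>.
  In dyadic scales \<open>B\<^sub>k\<close>, \<open>B\<close> is covered by \<open>M ^ k\<close> left translates of \<open>B\<^sub>k\<close>, so \<open>B\<^sub>k\<close> expands
  with constant \<open>C * M ^ k\<close>. Iterating over \<open>B\<^sub>0 B\<^sub>1 B\<^sub>2 \<dots>\<close>, a product that stays in a compact set \<open>K\<close>,
  the constants converge because \<open>\<Sum>k. k * r ^ k\<close> does, and \<open>\<mu> E powr (r ^ n)\<close> tends to \<open>1\<close>: hence
  \<open>\<mu> (K E) \<ge> c\<close> for all nonempty open \<open>E\<close>. Disjoint compact sets \<open>K x\<close> have disjoint neighbourhoods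
  of the form \<open>K E\<close>, so there are at most \<open>1 / c\<close> of them. Therefore every orbit is compact and there
  are finitely many orbits; they are clopen, and connectedness leaves only one. The orbit map is open
  because one of finitely many translates of a compact piece of the orbit has interior.
\<close>

section \<open>Topological groups and their actions\<close>

text \<open>The hypothesis supplies no constant: it only says that convolutions lie in
  \<open>L\<^sup>q\<close>. A uniform constant is forced by superposing ever worse counterexamples
  in one integrable series. The obstacle afterwards is compactness. Repeating the expansion with one
  fixed \<open>B\<close> sweeps out the powers of \<open>B\<close>, which need not stay in any
  compact set, while compactness of \<open>K\<close> is what makes orbit pieces closed and allows a
  tube argument. So the neighbourhoods must shrink, and the price is a constant that grows like
  \<open>M ^ k\<close>. The order of the factors makes this price bearable. The finest scale acts on
  \<open>E\<close> first, and the \<open>k\<close> coarser expansions that follow raise its constant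
  to the power \<open>r ^ k\<close>; in the opposite order the constants would not stay bounded.
  Finite dimension enters through \<open>M\<close>: the number of translates of
  \<open>B (Suc k)\<close> needed to cover \<open>B k\<close> is bounded independently of
  \<open>k\<close>. The centres of the same coverings, together with connectedness, yield a
  countable base of the group, which is what makes Tonelli available on the product with
  \<open>X\<close>.\<close>

lemma continuous_map_prod_box:
  assumes "continuous_map (prod_topology S T) R f" "openin R W"
    and "a \<in> topspace S" "b \<in> topspace T" "f (a, b) \<in> W"
  obtains P Q where "openin S P" "openin T Q" "a \<in> P" "b \<in> Q"
    "\<And>x y. x \<in> P \<Longrightarrow> y \<in> Q \<Longrightarrow> f (x, y) \<in> W"
proof -
  let ?Z = "{z \<in> topspace (prod_topology S T). f z \<in> W}"
  have "openin (prod_topology S T) ?Z"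
    using assms(1,2) by (rule openin_continuous_map_preimage)
  then have "(a, b) \<in> ?Z \<longrightarrow> (\<exists>U V. openin S U \<and> openin T V \<and> a \<in> U \<and> b \<in> V \<and> U \<times> V \<subseteq> ?Z)"
    unfolding openin_prod_topology_alt by (elim allE)
  moreover have "(a, b) \<in> ?Z" using assms by simp
  ultimately obtain P Q where PQ: "openin S P" "openin T Q" "a \<in> P" "b \<in> Q" "P \<times> Q \<subseteq> ?Z"
    by (elim impE exE conjE)
  show thesis using PQ(1-4)
  proof (rule that)
    show "f (x, y) \<in> W" if "x \<in> P" "y \<in> Q" for x y using that subsetD[OF PQ(5), of "(x, y)"] by simp
  qed
qed

locale topological_group = group G for G :: "('g, 'z) monoid_scheme" (structure) +
  fixes TG :: "'g topology"
  assumes topspace_eq [simp]: "topspace TG = carrier G"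
    and continuous_mult: "continuous_map (prod_topology TG TG) TG (\<lambda>(x, y). x \<otimes> y)"
    and continuous_inv: "continuous_map TG TG (\<lambda>x. inv x)"
begin

lemma openin_subset_carrier: "openin TG U \<Longrightarrow> U \<subseteq> carrier G"
  using openin_subset by fastforce

lemma continuous_mult_comp:
  assumes "continuous_map T TG f" "continuous_map T TG g"
  shows "continuous_map T TG (\<lambda>x. f x \<otimes> g x)"
  using continuous_map_compose[OF continuous_map_pairedI[OF assms] continuous_mult]
  by (simp add: o_def)

lemma continuous_inv_comp:
  assumes "continuous_map T TG f"
  shows "continuous_map T TG (\<lambda>x. inv (f x))"
  using continuous_map_compose[OF assms continuous_inv] by (simp add: o_def)

lemma openin_vimage:
  assumes "continuous_map TG TG f" "openin TG U"
  shows "openin TG {x \<in> carrier G. f x \<in> U}"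
  using openin_continuous_map_preimage[OF assms] by simp

lemma l_coset_eq_vimage:
  assumes "g \<in> carrier G" "U \<subseteq> carrier G"
  shows "l_coset G g U = {x \<in> carrier G. inv g \<otimes> x \<in> U}"
proof -
  have "x \<in> l_coset G g U" if "x \<in> carrier G" "inv g \<otimes> x \<in> U" for x
    unfolding l_coset_def using that assms
    by (auto intro!: bexI[of _ "inv g \<otimes> x"] simp: m_assoc[symmetric])
  moreover have "x \<in> carrier G \<and> inv g \<otimes> x \<in> U" if "x \<in> l_coset G g U" for x
    using that assms unfolding l_coset_def by (auto simp: m_assoc[symmetric] subset_iff)
  ultimately show ?thesis by blast
qed

lemma openin_l_coset:
  assumes "g \<in> carrier G" "openin TG U"
  shows "openin TG (l_coset G g U)"
  using assms openin_subset_carrier[OF assms(2)]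
  by (auto simp: l_coset_eq_vimage intro!: openin_vimage continuous_mult_comp)

lemma compactin_l_coset:
  assumes "g \<in> carrier G" "compactin TG C"
  shows "compactin TG (l_coset G g C)"
proof -
  have "l_coset G g C = (\<lambda>x. g \<otimes> x) ` C" by (auto simp: l_coset_def)
  moreover have "continuous_map TG TG (\<lambda>x. g \<otimes> x)"
    using assms by (intro continuous_mult_comp) auto
  ultimately show ?thesis using image_compactin[OF assms(2)] by metis
qed

text \<open>Continuity of \<open>inv x \<otimes> y\<close> at the identity. Quotients are the useful
  form because two points of one left translate of \<open>U\<close> differ by such a quotient,
  whichever translate it is.\<close>

lemma small_quotient_neighbourhood:
  assumes "openin TG W" "\<one> \<in> W"
  obtains U where "openin TG U" "\<one> \<in> U" "\<And>x y. x \<in> U \<Longrightarrow> y \<in> U \<Longrightarrow> inv x \<otimes> y \<in> W"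
proof -
  have "continuous_map (prod_topology TG TG) TG (\<lambda>z. inv (fst z) \<otimes> snd z)"
    by (intro continuous_mult_comp continuous_inv_comp continuous_map_fst continuous_map_snd)
  then obtain U1 U2 where U: "openin TG U1" "openin TG U2" "\<one> \<in> U1" "\<one> \<in> U2"
    and *: "\<And>x y. x \<in> U1 \<Longrightarrow> y \<in> U2 \<Longrightarrow> inv (fst (x, y)) \<otimes> snd (x, y) \<in> W"
    by (rule continuous_map_prod_box[OF _ assms(1), of TG TG _ \<one> \<one>]) (use assms in auto)
  show thesis
  proof (rule that[of "U1 \<inter> U2"])
    show "inv x \<otimes> y \<in> W" if "x \<in> U1 \<inter> U2" "y \<in> U1 \<inter> U2" for x y
      using that *[of x y] by simp
  qed (use U in auto)
qed

lemma locally_compact_if_compact_neighbourhood_one: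
  assumes "openin TG U" "\<one> \<in> U" "U \<subseteq> C" "compactin TG C"
  shows "locally_compact_space TG"
  unfolding locally_compact_space_def
proof
  fix g assume g: "g \<in> topspace TG"
  then have "g \<in> l_coset G g U" using assms(2) unfolding l_coset_def by force
  moreover have "l_coset G g U \<subseteq> l_coset G g C" using assms(3) unfolding l_coset_def by blast
  ultimately show "\<exists>U K. openin TG U \<and> compactin TG K \<and> g \<in> U \<and> U \<subseteq> K"
    using g assms openin_l_coset compactin_l_coset by (metis topspace_eq)
qed

text \<open>The closure of the words in \<open>D\<close> is stable under multiplication by \<open>U\<close>, hence clopen.\<close>
lemma countable_dense_if_connected:
  assumes conn: "connected_space TG" and U: "openin TG U" "\<one> \<in> U"
    and D: "countable D" "D \<subseteq> carrier G" "U \<subseteq> TG closure_of D"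
  obtains \<Gamma> where "countable \<Gamma>" "\<Gamma> \<subseteq> carrier G" "TG closure_of \<Gamma> = carrier G"
proof -
  define \<Gamma> where "\<Gamma> = (\<lambda>l. foldr (\<otimes>) l \<one>) ` lists D"
  define C where "C = TG closure_of \<Gamma>"
  have foldr: "foldr (\<otimes>) l \<one> \<in> carrier G" if "l \<in> lists D" for l
    using that D(2) by (induction l) auto
  then have sub: "\<Gamma> \<subseteq> carrier G" unfolding \<Gamma>_def by auto
  have one: "\<one> \<in> \<Gamma>" unfolding \<Gamma>_def by (rule image_eqI[of _ _ "[]"]) auto
  have mult: "d \<otimes> \<gamma> \<in> \<Gamma>" if "d \<in> D" "\<gamma> \<in> \<Gamma>" for d \<gamma>
    using that unfolding \<Gamma>_def by (auto intro!: image_eqI[of _ _ "d # _"])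
  have Ccl: "closedin TG C" and Csub: "C \<subseteq> carrier G"
    unfolding C_def using closure_of_subset_topspace[of TG \<Gamma>] by auto
  have UC: "u \<otimes> c \<in> C" if uU: "u \<in> U" and cC: "c \<in> C" for u c
    unfolding C_def in_closure_of
  proof (intro conjI allI impI)
    have u: "u \<in> carrier G" and c: "c \<in> carrier G"
      using uU cC openin_subset_carrier[OF U(1)] Csub by auto
    then show "u \<otimes> c \<in> topspace TG" by simp
    fix W assume W: "u \<otimes> c \<in> W \<and> openin TG W"
    then obtain P Q where PQ: "openin TG P" "openin TG Q" "u \<in> P" "c \<in> Q"
      and *: "\<And>x y. x \<in> P \<Longrightarrow> y \<in> Q \<Longrightarrow> (case (x, y) of (x, y) \<Rightarrow> x \<otimes> y) \<in> W"
      by (elim conjE, rule_tac continuous_map_prod_box[OF continuous_mult, of W u c]) (use u c in auto)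
    obtain d where d: "d \<in> D" "d \<in> P"
      using subsetD[OF D(3) uU] PQ unfolding in_closure_of by blast
    obtain \<gamma> where \<gamma>: "\<gamma> \<in> \<Gamma>" "\<gamma> \<in> Q"
      using cC PQ unfolding C_def in_closure_of by blast
    show "\<exists>y. y \<in> \<Gamma> \<and> y \<in> W"
      using mult[OF d(1) \<gamma>(1)] *[OF d(2) \<gamma>(2)] by auto
  qed
  have "openin TG C"
  proof (subst openin_subopen, intro ballI)
    fix c assume c: "c \<in> C"
    then have cG: "c \<in> carrier G" using Csub by auto
    \<comment> \<open>This is the right translate of \<open>U\<close> by \<open>c\<close>, so
      \<open>UC\<close> puts it inside \<open>C\<close>.\<close>
    let ?T = "{x \<in> carrier G. x \<otimes> inv c \<in> U}"
    have "openin TG ?T"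
      using cG U by (intro openin_vimage continuous_mult_comp) auto
    moreover have "c \<in> ?T" using cG U by simp
    moreover have "?T \<subseteq> C"
    proof
      fix x assume "x \<in> ?T"
      then show "x \<in> C" using UC[of "x \<otimes> inv c" c] c cG by (simp add: m_assoc)
    qed
    ultimately show "\<exists>T. openin TG T \<and> c \<in> T \<and> T \<subseteq> C" by blast
  qed
  moreover have "\<one> \<in> C" using one closure_of_subset[of \<Gamma> TG] sub unfolding C_def by auto
  ultimately have "C = carrier G"
    using conn Ccl unfolding connected_space_clopen_in by auto
  moreover have "countable \<Gamma>" unfolding \<Gamma>_def using D by auto
  ultimately show thesis using that sub unfolding C_def by auto
qed

text \<open>The left translates of the \<open>B k\<close> by \<open>\<Gamma>\<close> form a base: if
  \<open>\<gamma>\<close> is so close to \<open>g\<close> that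
  \<open>inv \<gamma> \<otimes> g\<close> lies in \<open>B k\<close>, then
  \<open>\<gamma> B k\<close> contains \<open>g\<close>, and each of its points is \<open>g\<close>
  times a quotient of two elements of \<open>B k\<close>.\<close>

lemma second_countable_if_dense:
  assumes \<Gamma>: "countable \<Gamma>" "\<Gamma> \<subseteq> carrier G" "TG closure_of \<Gamma> = carrier G"
    and B: "\<And>k::nat. openin TG (B k)" "\<And>k. \<one> \<in> B k"
      "\<And>W. openin TG W \<Longrightarrow> \<one> \<in> W \<Longrightarrow> \<exists>k. B k \<subseteq> W"
  shows "second_countable TG"
  unfolding second_countable_def
proof (intro exI conjI ballI allI impI)
  show "countable ((\<lambda>(\<gamma>, k). l_coset G \<gamma> (B k)) ` (\<Gamma> \<times> UNIV))" using \<Gamma> by auto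
  show "openin TG V" if "V \<in> (\<lambda>(\<gamma>, k). l_coset G \<gamma> (B k)) ` (\<Gamma> \<times> UNIV)" for V
    using that \<Gamma> B openin_l_coset by auto
  fix W g assume W: "openin TG W \<and> g \<in> W"
  then have g: "g \<in> carrier G" using openin_subset_carrier by auto
  have "openin TG {x \<in> carrier G. g \<otimes> x \<in> W}"
    using g W by (intro openin_vimage continuous_mult_comp) auto
  then obtain U where U: "openin TG U" "\<one> \<in> U"
    and UU: "\<And>x y. x \<in> U \<Longrightarrow> y \<in> U \<Longrightarrow> inv x \<otimes> y \<in> {x \<in> carrier G. g \<otimes> x \<in> W}"
    using small_quotient_neighbourhood[of "{x \<in> carrier G. g \<otimes> x \<in> W}"] g W by auto
  obtain k where k: "B k \<subseteq> U" using B(3) U by blast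
  have Bc: "B k \<subseteq> carrier G" using B openin_subset_carrier by auto
  have "openin TG {x \<in> carrier G. inv x \<otimes> g \<in> B k}"
    using g B by (intro openin_vimage continuous_mult_comp continuous_inv) auto
  moreover have "g \<in> {x \<in> carrier G. inv x \<otimes> g \<in> B k}" using g B by simp
  ultimately obtain \<gamma> where \<gamma>: "\<gamma> \<in> \<Gamma>" "\<gamma> \<in> carrier G" "inv \<gamma> \<otimes> g \<in> B k"
    using \<Gamma>(3) g by (smt (verit) in_closure_of mem_Collect_eq)
  have "g \<in> l_coset G \<gamma> (B k)" using g \<gamma> Bc by (simp add: l_coset_eq_vimage)
  moreover have "l_coset G \<gamma> (B k) \<subseteq> W"
  proof
    fix x assume "x \<in> l_coset G \<gamma> (B k)"
    then have x: "x \<in> carrier G" "inv \<gamma> \<otimes> x \<in> B k" using \<gamma> Bc by (auto simp: l_coset_eq_vimage)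
    have "g \<otimes> (inv (inv \<gamma> \<otimes> g) \<otimes> (inv \<gamma> \<otimes> x)) \<in> W"
      using UU[of "inv \<gamma> \<otimes> g" "inv \<gamma> \<otimes> x"] k \<gamma> x by auto
    moreover have "g \<otimes> (inv (inv \<gamma> \<otimes> g) \<otimes> (inv \<gamma> \<otimes> x)) = x"
      using g \<gamma> x by (simp add: inv_mult_group m_assoc[symmetric])
    ultimately show "x \<in> W" by simp
  qed
  moreover have "l_coset G \<gamma> (B k) \<in> (\<lambda>(\<gamma>, k). l_coset G \<gamma> (B k)) ` (\<Gamma> \<times> UNIV)"
    using \<gamma>(1) by (intro image_eqI[of _ _ "(\<gamma>, k)"]) auto
  ultimately show "\<exists>V\<in>(\<lambda>(\<gamma>, k). l_coset G \<gamma> (B k)) ` (\<Gamma> \<times> UNIV). g \<in> V \<and> V \<subseteq> W"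
    by (intro bexI[of _ "l_coset G \<gamma> (B k)"] conjI)
qed

text \<open>If \<open>K x\<close> and \<open>K y\<close> meet, then \<open>x\<close> is the image of
  \<open>y\<close> under such a quotient; this is how a largest disjoint family of orbit pieces
  turns into a cover.\<close>

lemma compactin_quotients:
  assumes "compactin TG K"
  shows "compactin TG {inv g \<otimes> h | g h. g \<in> K \<and> h \<in> K}"
proof -
  have "continuous_map (prod_topology TG TG) TG (\<lambda>z. inv (fst z) \<otimes> snd z)"
    by (intro continuous_mult_comp continuous_inv_comp continuous_map_fst continuous_map_snd)
  then have "compactin TG ((\<lambda>z. inv (fst z) \<otimes> snd z) ` (K \<times> K))"
    using assms by (intro image_compactin[where X = "prod_topology TG TG"]) (auto simp: compactin_Times)
  moreover have "(\<lambda>z. inv (fst z) \<otimes> snd z) ` (K \<times> K) = {inv g \<otimes> h | g h. g \<in> K \<and> h \<in> K}"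
    by force
  ultimately show ?thesis by simp
qed

text \<open>\<open>coset_topology\<close> is built with \<open>topology\<close>, which carries
  information only once its argument is known to satisfy \<open>istopology\<close>. The point is
  closure under intersection: distinct cosets are disjoint, so unions of families of cosets commute
  with intersections.\<close>

lemma openin_coset_topology:
  assumes H: "subgroup H G"
  shows "openin (coset_topology G TG H) U \<longleftrightarrow> U \<subseteq> rcosets H \<and> openin TG (\<Union>U)"
proof -
  have "\<Union>(U \<inter> U') = \<Union>U \<inter> \<Union>U'" if "U \<subseteq> rcosets H" "U' \<subseteq> rcosets H" for U U'
  proof -
    have "A = A'" if "A \<in> U" "A' \<in> U'" "x \<in> A" "x \<in> A'" for A A' x
      using that \<open>U \<subseteq> rcosets H\<close> \<open>U' \<subseteq> rcosets H\<close> rcos_disjoint[OF H]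
      unfolding pairwise_def disjnt_def by blast
    then show ?thesis by blast
  qed
  moreover have "openin TG (\<Union>(\<Union>\<K>))" if "\<forall>U\<in>\<K>. U \<subseteq> rcosets H \<and> openin TG (\<Union>U)" for \<K>
  proof -
    have "\<Union>(\<Union>\<K>) = (\<Union>U\<in>\<K>. \<Union>U)" by blast
    then show ?thesis using that by (auto intro: openin_Union)
  qed
  ultimately have "istopology (\<lambda>U. U \<subseteq> rcosets H \<and> openin TG (\<Union>U))"
    unfolding istopology_def by (auto simp: openin_Int)
  then show ?thesis unfolding coset_topology_def by (simp add: topology_inverse')
qed

lemma topspace_coset_topology:
  assumes H: "subgroup H G"
  shows "topspace (coset_topology G TG H) = rcosets H"
proof -
  have "openin TG (\<Union>(rcosets H))"
    using rcosets_part_G[OF H] openin_topspace[of TG] by simp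
  then show ?thesis unfolding topspace_def openin_coset_topology[OF H] by blast
qed

end

section \<open>Continuous actions and swept sets\<close>

locale topological_action = topological_group +
  fixes TX :: "'x topology" and act :: "'g \<Rightarrow> 'x \<Rightarrow> 'x"
  assumes g_space: "g_space G TG TX act"
begin

definition sweep :: "'g set \<Rightarrow> 'x set \<Rightarrow> 'x set" where
  "sweep S E = (\<Union>g\<in>S. act g ` E)"

lemma act_one: "x \<in> topspace TX \<Longrightarrow> act \<one> x = x"
  and act_mult: "g \<in> carrier G \<Longrightarrow> h \<in> carrier G \<Longrightarrow> x \<in> topspace TX \<Longrightarrow>
    act (g \<otimes> h) x = act g (act h x)"
  and continuous_act: "continuous_map (prod_topology TG TX) TX (\<lambda>(g, x). act g x)"
  using g_space unfolding g_space_def by auto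

lemma continuous_act_comp:
  assumes "continuous_map T TG f" "continuous_map T TX h"
  shows "continuous_map T TX (\<lambda>x. act (f x) (h x))"
  using continuous_map_compose[OF continuous_map_pairedI[OF assms] continuous_act]
  by (simp add: o_def)

lemma act_closed:
  assumes "g \<in> carrier G" "x \<in> topspace TX" shows "act g x \<in> topspace TX"
proof -
  have "(g, x) \<in> topspace (prod_topology TG TX)" using assms by simp
  then have "(case (g, x) of (g, x) \<Rightarrow> act g x) \<in> topspace TX"
    using continuous_map_image_subset_topspace[OF continuous_act] by blast
  then show ?thesis by simp
qed

lemma act_inv_act:
  assumes "g \<in> carrier G" "x \<in> topspace TX" shows "act (inv g) (act g x) = x" "act g (act (inv g) x) = x"
  using assms act_mult[of "inv g" g x] act_mult[of g "inv g" x] act_one by auto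

lemma act_image_eq_vimage:
  assumes "g \<in> carrier G" "E \<subseteq> topspace TX"
  shows "act g ` E = {x \<in> topspace TX. act (inv g) x \<in> E}"
proof (intro subset_antisym subsetI)
  fix x assume "x \<in> {x \<in> topspace TX. act (inv g) x \<in> E}"
  then have "x = act g (act (inv g) x)" "act (inv g) x \<in> E" using assms act_inv_act[of g x] by auto
  then show "x \<in> act g ` E" by (rule image_eqI)
next
  fix x assume "x \<in> act g ` E"
  then obtain e where "e \<in> E" "e \<in> topspace TX" "x = act g e" using assms(2) by blast
  then show "x \<in> {x \<in> topspace TX. act (inv g) x \<in> E}"
    using act_closed[of g e] act_inv_act(1)[of g e] assms(1) by simp
qed

lemma openin_act_image:
  assumes "g \<in> carrier G" "openin TX E" shows "openin TX (act g ` E)"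
proof -
  have "continuous_map TX TX (\<lambda>x. act (inv g) x)"
    using assms by (intro continuous_act_comp) auto
  then show ?thesis
    using openin_continuous_map_preimage[OF _ assms(2)] assms(1) openin_subset[OF assms(2)]
    by (simp add: act_image_eq_vimage)
qed

lemma openin_sweep:
  assumes "S \<subseteq> carrier G" "openin TX E" shows "openin TX (sweep S E)"
  unfolding sweep_def using assms openin_act_image by (intro openin_Union) auto

lemma sweep_mono: "S \<subseteq> S' \<Longrightarrow> E \<subseteq> E' \<Longrightarrow> sweep S E \<subseteq> sweep S' E'"
  unfolding sweep_def by auto

lemma sweep_superset:
  assumes "\<one> \<in> S" "E \<subseteq> topspace TX" shows "E \<subseteq> sweep S E"
proof
  fix x assume x: "x \<in> E"
  then have "act \<one> x = x" using act_one[OF subsetD[OF assms(2)]] by simp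
  then have "x \<in> act \<one> ` E" using image_eqI[OF _ x, of x "act \<one>"] by simp
  then show "x \<in> sweep S E"
    unfolding sweep_def using assms(1) by (rule UN_I[rotated])
qed

lemma sweep_sweep:
  assumes "S \<subseteq> carrier G" "S' \<subseteq> carrier G" "E \<subseteq> topspace TX"
  shows "sweep S (sweep S' E) = sweep (S <#> S') E"
proof -
  have "act g (act h x) = act (g \<otimes> h) x" if "g \<in> S" "h \<in> S'" "x \<in> E" for g h x
    using that assms by (subst act_mult) auto
  then show ?thesis unfolding sweep_def set_mult_def by (simp add: image_UN image_image) blast
qed

lemma compactin_orbit_piece:
  assumes "compactin TG C" "x \<in> topspace TX"
  shows "compactin TX ((\<lambda>g. act g x) ` C)"
proof -
  have "continuous_map TG TX (\<lambda>g. act g x)"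
    using assms(2) by (intro continuous_act_comp) auto
  then show ?thesis using assms(1) image_compactin by blast
qed

end

section \<open>Finitely many orbit pieces\<close>

text \<open>Induction: the new compact set is separated from the union of the old ones, and the old
  neighbourhoods are cut down accordingly.\<close>

lemma Hausdorff_space_finite_compact_separation:
  assumes "Hausdorff_space X" "finite F"
    and "\<And>x. x \<in> F \<Longrightarrow> compactin X (C x)" "pairwise (\<lambda>x y. disjnt (C x) (C y)) F"
  shows "\<exists>W. (\<forall>x\<in>F. openin X (W x) \<and> C x \<subseteq> W x) \<and> disjoint_family_on W F"
  using assms(2-)
proof (induction F rule: finite_induct)
  case empty
  then show ?case by (simp add: disjoint_family_on_def)
next
  case (insert x F)
  then have "\<exists>W. (\<forall>x\<in>F. openin X (W x) \<and> C x \<subseteq> W x) \<and> disjoint_family_on W F"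
    by (auto simp: pairwise_insert)
  then obtain W where W: "\<forall>y\<in>F. openin X (W y) \<and> C y \<subseteq> W y" "disjoint_family_on W F"
    by blast
  have "compactin X (\<Union>(C ` F))" using insert by (intro compactin_Union) auto
  moreover have "disjnt (C x) (\<Union>(C ` F))"
    using insert.prems(2) insert.hyps unfolding pairwise_insert by (auto simp: disjnt_def)
  ultimately obtain U U' where U: "openin X U" "openin X U'" "C x \<subseteq> U" "\<Union>(C ` F) \<subseteq> U'" "disjnt U U'"
    using Hausdorff_space_compact_separation[OF assms(1), of "C x" "\<Union>(C ` F)"] insert.prems by auto
  let ?W = "\<lambda>y. if y = x then U else W y \<inter> U'"
  have "\<forall>y\<in>insert x F. openin X (?W y) \<and> C y \<subseteq> ?W y"
    using U W(1) by auto
  moreover have "disjoint_family_on ?W (insert x F)"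
    using U(5) W(2) insert.hyps(2) unfolding disjoint_family_on_def disjnt_def by auto
  ultimately show ?case by (intro exI[of _ ?W] conjI)
qed

text \<open>A finite version of the Baire argument: either \<open>U\<close> lies in
  \<open>A i\<close>, or \<open>U - A i\<close> is a nonempty open set covered by the remaining
  sets.\<close>

lemma finite_closed_cover_interior:
  assumes "finite I" "\<And>i. i \<in> I \<Longrightarrow> closedin X (A i)" "openin X U" "U \<noteq> {}" "U \<subseteq> (\<Union>i\<in>I. A i)"
  shows "\<exists>i\<in>I. \<exists>P. openin X P \<and> P \<noteq> {} \<and> P \<subseteq> A i"
  using assms
proof (induction I arbitrary: U rule: finite_induct)
  case (insert i I)
  show ?case
  proof (cases "U \<subseteq> A i")
    case False
    have "openin X (U - A i)" using insert.prems by (intro openin_diff) auto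
    then have "\<exists>j\<in>I. \<exists>P. openin X P \<and> P \<noteq> {} \<and> P \<subseteq> A j"
      using insert.prems False by (intro insert.IH[of "U - A i"]) auto
    then show ?thesis by blast
  qed (use insert.prems in blast)
qed auto

context topological_action
begin

lemma disjoint_orbit_pieces_bound:
  fixes \<mu> :: "'x measure"
  assumes haus: "Hausdorff_space TX" and K: "compactin TG K"
    and S: "S \<subseteq> K"
    and prob: "prob_space \<mu>" and sets: "\<And>U. openin TX U \<Longrightarrow> U \<in> sets \<mu>"
    and c: "\<And>E. openin TX E \<Longrightarrow> E \<noteq> {} \<Longrightarrow> c \<le> measure \<mu> (sweep S E)"
    and F: "finite F" "F \<subseteq> topspace TX"
      "pairwise (\<lambda>x y. disjnt ((\<lambda>g. act g x) ` K) ((\<lambda>g. act g y) ` K)) F"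
  shows "real (card F) * c \<le> 1"
proof -
  interpret prob_space \<mu> by fact
  have KG: "K \<subseteq> carrier G" using compactin_subset_topspace[OF K] by simp
  have comp: "compactin TX ((\<lambda>g. act g x) ` K)" if "x \<in> F" for x
    using compactin_orbit_piece[OF K] that F(2) by blast
  obtain W where W: "\<And>x. x \<in> F \<Longrightarrow> openin TX (W x)" "\<And>x. x \<in> F \<Longrightarrow> (\<lambda>g. act g x) ` K \<subseteq> W x"
    and disj: "disjoint_family_on W F"
    using Hausdorff_space_finite_compact_separation[OF haus F(1) comp F(3)] by auto
  have "\<exists>E. openin TX E \<and> x \<in> E \<and> sweep S E \<subseteq> W x" if x: "x \<in> F" for x
  proof -
    \<comment> \<open>Tube lemma: compactness of \<open>K\<close> yields one neighbourhood of
      \<open>x\<close> that all of \<open>K\<close> maps into \<open>W x\<close>.\<close>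
    let ?Z = "{z \<in> topspace (prod_topology TG TX). (case z of (g, x) \<Rightarrow> act g x) \<in> W x}"
    have "openin (prod_topology TG TX) ?Z"
      using continuous_act W(1)[OF x] by (rule openin_continuous_map_preimage)
    moreover have "K \<times> {x} \<subseteq> ?Z" using KG W(2)[OF x] x F(2) by auto
    ultimately obtain U E where "openin TG U" "openin TX E" "K \<subseteq> U" "x \<in> E" and UE: "U \<times> E \<subseteq> ?Z"
      using tube_lemma_left[of TG TX ?Z K x] K x F(2) by blast
    moreover have "sweep S E \<subseteq> W x"
    proof
      fix y assume "y \<in> sweep S E"
      then obtain g e where "g \<in> S" "e \<in> E" "y = act g e" unfolding sweep_def by blast
      moreover from this have "(g, e) \<in> ?Z" using UE S \<open>K \<subseteq> U\<close> by blast
      ultimately show "y \<in> W x" by simp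
    qed
    ultimately show ?thesis by blast
  qed
  then obtain E where E: "\<And>x. x \<in> F \<Longrightarrow> openin TX (E x)" "\<And>x. x \<in> F \<Longrightarrow> x \<in> E x"
    "\<And>x. x \<in> F \<Longrightarrow> sweep S (E x) \<subseteq> W x" by metis
  have op: "openin TX (sweep S (E x))" if "x \<in> F" for x
    using that E(1) S KG by (intro openin_sweep) auto
  have "disjoint_family_on (\<lambda>x. sweep S (E x)) F"
    using disj E(3) unfolding disjoint_family_on_def by blast
  then have "measure \<mu> (\<Union>x\<in>F. sweep S (E x)) = (\<Sum>x\<in>F. measure \<mu> (sweep S (E x)))"
    using F(1) op sets by (intro finite_measure_finite_Union) auto
  moreover have "(\<Sum>x\<in>F. measure \<mu> (sweep S (E x))) \<ge> (\<Sum>x\<in>F. c)"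
    using E(1,2) by (intro sum_mono c) blast+
  ultimately show ?thesis using prob_le_1[of "\<Union>x\<in>F. sweep S (E x)"] by simp
qed

text \<open>Take a disjoint family of largest size. Any further \<open>K x\<close> must meet some
  \<open>K y\<close>, and \<open>act g x = act h y\<close> means
  \<open>x = act (inv g \<otimes> h) y\<close>.\<close>

lemma finite_cover_by_orbit_pieces:
  assumes K: "compactin TG K" "K \<noteq> {}"
    and bound: "\<And>F. finite F \<Longrightarrow> F \<subseteq> topspace TX \<Longrightarrow>
      pairwise (\<lambda>x y. disjnt ((\<lambda>g. act g x) ` K) ((\<lambda>g. act g y) ` K)) F \<Longrightarrow> card F \<le> N"
  obtains F where "finite F" "F \<subseteq> topspace TX"
    "topspace TX = (\<Union>y\<in>F. (\<lambda>g. act g y) ` {inv g \<otimes> h | g h. g \<in> K \<and> h \<in> K})"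
proof -
  have KG: "K \<subseteq> carrier G" using compactin_subset_topspace[OF K(1)] by simp
  let ?D = "\<lambda>x y. disjnt ((\<lambda>g. act g x) ` K) ((\<lambda>g. act g y) ` K)"
  let ?P = "\<lambda>F. finite F \<and> F \<subseteq> topspace TX \<and> pairwise ?D F"
  \<comment> \<open>\<open>ex_has_greatest_nat\<close> asks for a strict bound, hence
    \<open>Suc N\<close>; the empty family shows that there is something to maximise.\<close>
  have "\<exists>F. ?P F \<and> (\<forall>F'. ?P F' \<longrightarrow> card F' \<le> card F)"
    using bound by (intro Lattices_Big.ex_has_greatest_nat[of ?P "{}" card "Suc N"]) (auto simp: less_Suc_eq_le)
  then obtain F where F: "?P F" and max: "\<forall>F'. ?P F' \<longrightarrow> card F' \<le> card F"
    by (elim exE conjE[of "?P _"])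
  let ?L = "{inv g \<otimes> h | g h. g \<in> K \<and> h \<in> K}"
  have "x \<in> (\<Union>y\<in>F. (\<lambda>g. act g y) ` ?L)" if x: "x \<in> topspace TX" for x
  proof -
    have "\<exists>y\<in>F. \<not> ?D x y"
    proof (rule ccontr)
      assume neg: "\<not> ?thesis"
      \<comment> \<open>\<open>K x\<close> meets itself because \<open>K\<close> is nonempty, so
        \<open>x\<close> in \<open>F\<close> would contradict \<open>neg\<close>. Hence inserting
        \<open>x\<close> really increases the cardinality.\<close>
      have "x \<notin> F" using neg K(2) by auto
      moreover have "?P (insert x F)"
        using F neg x by (auto simp: pairwise_insert disjnt_sym)
      ultimately show False using max[rule_format, of "insert x F"] F by simp
    qed
    then obtain y g h where y: "y \<in> F" and gh: "g \<in> K" "h \<in> K" "act g x = act h y"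
      unfolding disjnt_def by auto
    have yX: "y \<in> topspace TX" using y F by auto
    have "x = act (inv g \<otimes> h) y"
      using act_inv_act(1)[of g x] gh KG x yX act_mult[of "inv g" h y] by (auto simp: subset_iff)
    then show ?thesis using y gh by blast
  qed
  moreover have "(\<Union>y\<in>F. (\<lambda>g. act g y) ` ?L) \<subseteq> topspace TX"
  proof
    fix x assume "x \<in> (\<Union>y\<in>F. (\<lambda>g. act g y) ` ?L)"
    then obtain y g h where "y \<in> F" "g \<in> K" "h \<in> K" "x = act (inv g \<otimes> h) y" by blast
    then show "x \<in> topspace TX" using F KG act_closed[of "inv g \<otimes> h" y] by (simp add: subset_iff)
  qed
  ultimately have "topspace TX = (\<Union>y\<in>F. (\<lambda>g. act g y) ` ?L)"
    by (intro subset_antisym subsetI) (assumption, erule (1) subsetD)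
  then show thesis using F that[of F] by simp
qed

text \<open>An orbit contains a piece \<open>L y\<close> entirely or misses it. So the orbit of
  \<open>x0\<close> and its complement are both finite unions of compact pieces, hence closed, and
  connectedness makes the orbit everything.\<close>

lemma transitive_and_compact:
  assumes haus: "Hausdorff_space TX" and conn: "connected_space TX"
    and F: "finite F" "F \<subseteq> topspace TX" and L: "compactin TG L"
    and cover: "topspace TX = (\<Union>y\<in>F. (\<lambda>g. act g y) ` L)"
    and x0: "x0 \<in> topspace TX"
  obtains C where "compactin TG C" "topspace TX = (\<lambda>g. act g x0) ` C"
proof -
  have LG: "L \<subseteq> carrier G" using compactin_subset_topspace[OF L] by simp
  let ?orb = "(\<lambda>g. act g x0) ` carrier G"
  have piece: "closedin TX ((\<lambda>g. act g y) ` L)" if "y \<in> F" for y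
    using compactin_orbit_piece[OF L, of y] that F(2) compactin_imp_closedin[OF haus] by blast
  have orb_act: "act g y \<in> ?orb \<longleftrightarrow> y \<in> ?orb" if g: "g \<in> carrier G" and y: "y \<in> topspace TX" for g y
  proof
    assume "act g y \<in> ?orb"
    then obtain h where h: "h \<in> carrier G" "act g y = act h x0" by blast
    then have "y = act (inv g \<otimes> h) x0" using act_inv_act(1)[OF g y] act_mult[of "inv g" h x0] g x0 by simp
    then show "y \<in> ?orb" using g h by blast
  next
    assume "y \<in> ?orb"
    then obtain h where h: "h \<in> carrier G" "y = act h x0" by blast
    then have "act g y = act (g \<otimes> h) x0" using act_mult[of g h x0] g x0 by simp
    then show "act g y \<in> ?orb" using g h by blast
  qed
  have orbX: "?orb \<subseteq> topspace TX" using act_closed x0 by blast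
  let ?F = "F \<inter> ?orb"
  have in_orb: "x \<in> (\<Union>y\<in>?F. (\<lambda>g. act g y) ` L)" if "x \<in> ?orb" for x
  proof -
    obtain y g where yg: "y \<in> F" "g \<in> L" "x = act g y" using cover orbX \<open>x \<in> ?orb\<close> by blast
    then have "y \<in> ?orb" using orb_act[of g y] LG F(2) \<open>x \<in> ?orb\<close> by auto
    then show ?thesis using yg by blast
  qed
  have orb_eq: "?orb = (\<Union>y\<in>?F. (\<lambda>g. act g y) ` L)"
  proof (intro subset_antisym subsetI)
    fix x assume "x \<in> (\<Union>y\<in>?F. (\<lambda>g. act g y) ` L)"
    then obtain y g where yg: "y \<in> F" "y \<in> ?orb" "g \<in> L" "x = act g y" by blast
    then show "x \<in> ?orb" using orb_act[of g y] LG F(2) by auto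
  qed (rule in_orb)
  have "topspace TX - ?orb = (\<Union>y\<in>F - ?orb. (\<lambda>g. act g y) ` L)"
  proof (intro subset_antisym subsetI)
    fix x assume x: "x \<in> topspace TX - ?orb"
    then obtain y g where yg: "y \<in> F" "g \<in> L" "x = act g y" using cover by blast
    then have "y \<notin> ?orb" using orb_act[of g y] LG F(2) x by auto
    then show "x \<in> (\<Union>y\<in>F - ?orb. (\<lambda>g. act g y) ` L)" using yg by blast
  next
    fix x assume "x \<in> (\<Union>y\<in>F - ?orb. (\<lambda>g. act g y) ` L)"
    then obtain y g where yg: "y \<in> F" "y \<notin> ?orb" "g \<in> L" "x = act g y" by blast
    then have "x \<notin> ?orb" using orb_act[of g y] LG F(2) by auto
    then show "x \<in> topspace TX - ?orb" using yg cover by blast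
  qed
  moreover have "closedin TX (\<Union>y\<in>F - ?orb. (\<lambda>g. act g y) ` L)"
    using F piece by (intro closedin_Union) auto
  ultimately have "openin TX ?orb" using orbX by (simp add: openin_closedin)
  moreover have "closedin TX ?orb"
    by (subst orb_eq) (use F piece in \<open>intro closedin_Union; auto\<close>)
  moreover have "?orb \<noteq> {}" by auto
  ultimately have orb_top: "?orb = topspace TX"
    using conn unfolding connected_space_clopen_in by blast
  have "\<forall>y\<in>F. \<exists>g. g \<in> carrier G \<and> y = act g x0" using orb_top F(2) by blast
  then obtain r where r: "\<And>y. y \<in> F \<Longrightarrow> r y \<in> carrier G \<and> y = act (r y) x0"
    by metis
  \<comment> \<open>Replacing each \<open>y\<close> by \<open>act (r y) x0\<close> moves the
    finitely many pieces into one compact subset of the group acting on the single point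
    \<open>x0\<close>.\<close>
  let ?C = "\<Union>y\<in>F. (\<lambda>g. g \<otimes> r y) ` L"
  have "compactin TG ((\<lambda>g. g \<otimes> r y) ` L)" if "y \<in> F" for y
    using r[OF that] by (intro image_compactin[OF L] continuous_mult_comp) auto
  then have "compactin TG ?C" using F(1) by (intro compactin_Union) auto
  moreover have "(\<lambda>g. act g x0) ` ?C = (\<Union>y\<in>F. (\<lambda>g. act g y) ` L)"
  proof -
    have "(\<lambda>g. act (g \<otimes> r y) x0) ` L = (\<lambda>g. act g y) ` L" if "y \<in> F" for y
      using r[OF that] LG x0 act_mult by (intro image_cong) auto
    then show ?thesis by (auto simp: image_UN image_image)
  qed
  ultimately show thesis using that[of ?C] cover by simp
qed

lemma orbit_map_open:
  assumes haus: "Hausdorff_space TX" "Hausdorff_space TG" and lc: "locally_compact_space TG"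
    and x0: "x0 \<in> topspace TX" and C: "compactin TG C" "topspace TX = (\<lambda>g. act g x0) ` C"
    and W: "openin TG W"
  shows "openin TX ((\<lambda>g. act g x0) ` W)"
proof (subst openin_subopen, intro ballI)
  fix x assume "x \<in> (\<lambda>g. act g x0) ` W"
  then obtain w where w: "w \<in> W" "x = act w x0" by blast
  have wG: "w \<in> carrier G" using w W openin_subset_carrier by auto
  have "openin TG {x \<in> carrier G. w \<otimes> x \<in> W}"
    using wG W by (intro openin_vimage continuous_mult_comp) auto
  then obtain U where U: "openin TG U" "\<one> \<in> U"
    and UU: "\<And>x y. x \<in> U \<Longrightarrow> y \<in> U \<Longrightarrow> inv x \<otimes> y \<in> {x \<in> carrier G. w \<otimes> x \<in> W}"
    by (rule small_quotient_neighbourhood) (use w wG in auto)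
  have "neighbourhood_base_of (compactin TG) TG"
    using lc haus(2) locally_compact_space_neighbourhood_base by blast
  then have "\<exists>O' Q. openin TG O' \<and> compactin TG Q \<and> \<one> \<in> O' \<and> O' \<subseteq> Q \<and> Q \<subseteq> U"
    using U unfolding neighbourhood_base_of by simp
  then obtain O' Q where O': "openin TG O'" "\<one> \<in> O'" "O' \<subseteq> Q" and Q: "compactin TG Q" "Q \<subseteq> U"
    by (elim exE conjE)
  have QG: "Q \<subseteq> carrier G" using compactin_subset_topspace[OF Q(1)] by simp
  have CG: "C \<subseteq> carrier G" using compactin_subset_topspace[OF C(1)] by simp
  have "\<exists>\<F>. finite \<F> \<and> \<F> \<subseteq> (\<lambda>g. l_coset G g O') ` C \<and> C \<subseteq> \<Union>\<F>"
  proof (rule compactinD[OF C(1)])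
    show "openin TG U" if "U \<in> (\<lambda>g. l_coset G g O') ` C" for U
      using that openin_l_coset O'(1) CG by auto
    show "C \<subseteq> \<Union>((\<lambda>g. l_coset G g O') ` C)"
    proof
      fix g assume g: "g \<in> C"
      then have "g = g \<otimes> \<one>" using CG by auto
      then have "g \<in> l_coset G g O'" using O'(2) unfolding l_coset_def by blast
      then show "g \<in> \<Union>((\<lambda>g. l_coset G g O') ` C)" using g by blast
    qed
  qed
  then obtain I where I: "finite I" "I \<subseteq> C" "C \<subseteq> (\<Union>g\<in>I. l_coset G g O')"
    by (metis finite_subset_image)
  let ?A = "\<lambda>g. (\<lambda>h. act h x0) ` (l_coset G g Q)"
  have "\<exists>g\<in>I. \<exists>P. openin TX P \<and> P \<noteq> {} \<and> P \<subseteq> ?A g"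
  proof (rule finite_closed_cover_interior[OF I(1)])
    show "closedin TX (?A g)" if "g \<in> I" for g
      using that I(2) CG Q(1) x0 by (intro compactin_imp_closedin[OF haus(1)] compactin_orbit_piece compactin_l_coset) auto
    show "openin TX (topspace TX)" "topspace TX \<noteq> {}" using x0 by auto
    have "C \<subseteq> (\<Union>g\<in>I. l_coset G g Q)" using I(3) O'(3) unfolding l_coset_def by blast
    then show "topspace TX \<subseteq> (\<Union>g\<in>I. ?A g)" unfolding C(2) by blast
  qed
  then obtain g P where g: "g \<in> I" and P: "openin TX P" "P \<noteq> {}" "P \<subseteq> ?A g" by blast
  have gG: "g \<in> carrier G" using g I(2) CG by auto
  obtain q where q: "q \<in> Q" "act (g \<otimes> q) x0 \<in> P"
    using P unfolding l_coset_def by blast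
  have qG: "q \<in> carrier G" using q QG by auto
  \<comment> \<open>\<open>t\<close> carries the interior point
    \<open>act (g \<otimes> q) x0\<close> to \<open>act w x0\<close>. Any other point
    \<open>act (g \<otimes> q') x0\<close> of \<open>P\<close> goes to
    \<open>act (w \<otimes> (inv q \<otimes> q')) x0\<close>; the set \<open>U\<close> was chosen so
    that \<open>w \<otimes> (inv q \<otimes> q')\<close> stays in \<open>W\<close>.\<close>
  define t where "t = w \<otimes> inv (g \<otimes> q)"
  have tG: "t \<in> carrier G" unfolding t_def using wG gG qG by simp
  have "openin TX (act t ` P)" using tG P(1) by (rule openin_act_image)
  moreover have "x \<in> act t ` P"
  proof -
    have "act t (act (g \<otimes> q) x0) = x"
      using act_mult[of t "g \<otimes> q" x0] tG gG qG x0 wG w(2) unfolding t_def by (simp add: m_assoc)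
    then show ?thesis using q(2) by blast
  qed
  moreover have "act t ` P \<subseteq> (\<lambda>g. act g x0) ` W"
  proof
    fix y assume "y \<in> act t ` P"
    then obtain q' where q': "q' \<in> Q" "y = act t (act (g \<otimes> q') x0)"
      using P(3) unfolding l_coset_def by blast
    have q'G: "q' \<in> carrier G" using q' QG by auto
    have "y = act (w \<otimes> (inv q \<otimes> q')) x0"
    proof -
      have "t \<otimes> (g \<otimes> q') = w \<otimes> (inv q \<otimes> q')"
        unfolding t_def using wG gG qG q'G
        by (simp add: inv_mult_group m_assoc) (simp add: m_assoc[symmetric])
      then show ?thesis using q' act_mult[of t "g \<otimes> q'" x0] tG gG q'G x0 by simp
    qed
    moreover have "w \<otimes> (inv q \<otimes> q') \<in> W" using UU[of q q'] q q' Q(2) by auto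
    ultimately show "y \<in> (\<lambda>g. act g x0) ` W" by blast
  qed
  ultimately show "\<exists>T. openin TX T \<and> x \<in> T \<and> T \<subseteq> (\<lambda>g. act g x0) ` W" by blast
qed

section \<open>Identification of an orbit with the coset space of a stabilizer\<close>

definition stabilizer :: "'x \<Rightarrow> 'g set" where
  "stabilizer x = {g \<in> carrier G. act g x = x}"

lemma subgroup_stabilizer:
  assumes x: "x \<in> topspace TX"
  shows "subgroup (stabilizer x) G"
proof
  show "g \<otimes> h \<in> stabilizer x" if "g \<in> stabilizer x" "h \<in> stabilizer x" for g h
    using that x act_mult[of g h x] unfolding stabilizer_def by simp
  show "inv g \<in> stabilizer x" if "g \<in> stabilizer x" for g
    using that x act_inv_act(1)[of g x] unfolding stabilizer_def by simp
qed (use x act_one in \<open>auto simp: stabilizer_def\<close>)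

lemma closedin_stabilizer:
  assumes "Hausdorff_space TX" "x \<in> topspace TX"
  shows "closedin TG (stabilizer x)"
proof -
  have "continuous_map TG TX (\<lambda>g. act g x)"
    using assms by (intro continuous_act_comp) auto
  moreover have "closedin TX {x}" using assms by (simp add: closedin_Hausdorff_sing_eq)
  ultimately have "closedin TG {g \<in> topspace TG. act g x \<in> {x}}"
    by (rule closedin_continuous_map_preimage)
  then show ?thesis unfolding stabilizer_def by simp
qed

lemma coset_space_iso_stabilizer:
  assumes x0: "x0 \<in> topspace TX"
    and trans: "topspace TX = (\<lambda>g. act g x0) ` carrier G"
    and op: "\<And>W. openin TG W \<Longrightarrow> openin TX ((\<lambda>g. act g x0) ` W)"
  shows "coset_space_iso G TG TX act (stabilizer x0)"
proof -
  let ?H = "stabilizer x0"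
  have H: "subgroup ?H G" using x0 by (rule subgroup_stabilizer)
  have HG: "?H \<subseteq> carrier G" unfolding stabilizer_def by blast
  \<comment> \<open>No \<open>g\<close> with \<open>x = act g x0\<close> is chosen, so there is no
    well-definedness to check. For such \<open>g\<close> this set is the right coset of
    \<open>inv g\<close>, and the inverse is what matches the action by right multiplication with
    \<open>inv g\<close>.\<close>
  define \<Phi> where "\<Phi> x = {h \<in> carrier G. act h x = x0}" for x
  have \<Phi>: "\<Phi> (act g x0) = ?H #> inv g" if g: "g \<in> carrier G" for g
  proof (intro subset_antisym subsetI)
    fix h assume "h \<in> \<Phi> (act g x0)"
    then have h: "h \<in> carrier G" "act h (act g x0) = x0" unfolding \<Phi>_def by auto
    then have "h \<otimes> g \<in> ?H" using act_mult[of h g x0] g x0 unfolding stabilizer_def by simp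
    moreover have "h = (h \<otimes> g) \<otimes> inv g" using g h by (simp add: m_assoc)
    ultimately show "h \<in> ?H #> inv g" unfolding r_coset_def by blast
  next
    fix h assume "h \<in> ?H #> inv g"
    then obtain k where k: "k \<in> carrier G" "act k x0 = x0" "h = k \<otimes> inv g"
      unfolding r_coset_def stabilizer_def by blast
    then have "act h (act g x0) = act (k \<otimes> inv g \<otimes> g) x0"
      using act_mult[of h g x0] g x0 by simp
    then have "act h (act g x0) = x0" using k g by (simp add: m_assoc)
    then show "h \<in> \<Phi> (act g x0)" unfolding \<Phi>_def using k g by simp
  qed
  have mem: "?H #> inv g \<in> U \<longleftrightarrow> inv g \<in> \<Union>U" if U: "U \<subseteq> rcosets ?H" and g: "g \<in> carrier G" for U g
  proof
    assume "?H #> inv g \<in> U"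
    then show "inv g \<in> \<Union>U" using rcos_self[OF _ H, of "inv g"] g by blast
  next
    assume "inv g \<in> \<Union>U"
    then obtain A where A: "A \<in> U" "inv g \<in> A" by blast
    then obtain a where "a \<in> carrier G" "A = ?H #> a" using U unfolding RCOSETS_def by blast
    then have "A = ?H #> inv g" using repr_independence[OF _ _ H, of "inv g" a] A by simp
    then show "?H #> inv g \<in> U" using A by simp
  qed
  have image: "\<Phi> ` topspace TX = rcosets ?H"
  proof (intro subset_antisym subsetI)
    fix A assume "A \<in> rcosets ?H"
    then obtain a where a: "a \<in> carrier G" "A = ?H #> a" unfolding RCOSETS_def by blast
    then have "A = \<Phi> (act (inv a) x0)" using \<Phi>[of "inv a"] by simp
    then show "A \<in> \<Phi> ` topspace TX" using a act_closed[of "inv a" x0] x0 by blast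
  next
    fix A assume "A \<in> \<Phi> ` topspace TX"
    then obtain g where "g \<in> carrier G" "A = \<Phi> (act g x0)" unfolding trans by blast
    then have "inv g \<in> carrier G" "A = ?H #> inv g" using \<Phi>[of g] by auto
    then show "A \<in> rcosets ?H" unfolding RCOSETS_def by blast
  qed
  \<comment> \<open>A homeomorphism is an injective quotient map. Continuity of the orbit map,
    composed with inversion, gives one implication between open sets, and its openness
    \<open>op\<close> gives the other.\<close>
  have "quotient_map TX (coset_topology G TG ?H) \<Phi>"
    unfolding quotient_map_def topspace_coset_topology[OF H] openin_coset_topology[OF H]
  proof (intro conjI allI impI)
    show "\<Phi> ` topspace TX = rcosets ?H" by (fact image)
    fix U assume U: "U \<subseteq> rcosets ?H"
    let ?S = "{x \<in> topspace TX. \<Phi> x \<in> U}"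
    have S: "act g x0 \<in> ?S \<longleftrightarrow> inv g \<in> \<Union>U" if "g \<in> carrier G" for g
      using mem[OF U that] \<Phi>[OF that] act_closed[OF that x0] by simp
    have UG: "\<Union>U \<subseteq> carrier G" using U rcosets_part_G[OF H] by blast
    have "openin TG (\<Union>U)" if "openin TX ?S"
    proof -
      have "continuous_map TG TX (\<lambda>g. act (inv g) x0)"
        using x0 by (intro continuous_act_comp continuous_inv) auto
      then have "openin TG {g \<in> topspace TG. act (inv g) x0 \<in> ?S}"
        using that by (rule openin_continuous_map_preimage)
      moreover have "{g \<in> topspace TG. act (inv g) x0 \<in> ?S} = \<Union>U"
      proof (intro subset_antisym subsetI)
        fix g assume "g \<in> {g \<in> topspace TG. act (inv g) x0 \<in> ?S}"
        then show "g \<in> \<Union>U" using S[of "inv g"] by simp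
      next
        fix g assume gU: "g \<in> \<Union>U"
        then have "g \<in> carrier G" using UG by (rule subsetD[rotated])
        then show "g \<in> {g \<in> topspace TG. act (inv g) x0 \<in> ?S}" using S[of "inv g"] gU by simp
      qed
      ultimately show ?thesis by simp
    qed
    moreover have "openin TX ?S" if "openin TG (\<Union>U)"
    proof -
      have "openin TX ((\<lambda>g. act g x0) ` {g \<in> carrier G. inv g \<in> \<Union>U})"
        using that by (intro op openin_vimage continuous_inv)
      moreover have "(\<lambda>g. act g x0) ` {g \<in> carrier G. inv g \<in> \<Union>U} = ?S"
      proof (intro subset_antisym subsetI)
        fix x assume "x \<in> (\<lambda>g. act g x0) ` {g \<in> carrier G. inv g \<in> \<Union>U}"
        then show "x \<in> ?S" using S by blast
      next
        fix x assume x: "x \<in> ?S"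
        then obtain g where "g \<in> carrier G" "x = act g x0" unfolding trans by blast
        then show "x \<in> (\<lambda>g. act g x0) ` {g \<in> carrier G. inv g \<in> \<Union>U}" using S[of g] x by blast
      qed
      ultimately show ?thesis by simp
    qed
    ultimately show "openin TX ?S = (U \<subseteq> rcosets ?H \<and> openin TG (\<Union>U))" using U by blast
  qed
  moreover have "inj_on \<Phi> (topspace TX)"
  proof (rule inj_onI)
    fix x y assume "x \<in> topspace TX" "y \<in> topspace TX" and eq: "\<Phi> x = \<Phi> y"
    then obtain g where g: "g \<in> carrier G" "x = act g x0" unfolding trans by blast
    have "inv g \<in> \<Phi> x" unfolding \<Phi>_def using g x0 act_inv_act(1)[of g x0] by simp
    then have "inv g \<in> \<Phi> y" using eq by simp
    then have "act (inv g) y = x0" unfolding \<Phi>_def by blast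
    then show "x = y" using act_inv_act(2)[of g y] g \<open>y \<in> topspace TX\<close> by simp
  qed
  moreover have "\<Phi> (act g x) = \<Phi> x #> inv g" if g: "g \<in> carrier G" and x: "x \<in> topspace TX" for g x
  proof -
    obtain h where h: "h \<in> carrier G" "x = act h x0" using x unfolding trans by blast
    then have "\<Phi> (act g x) = ?H #> inv (g \<otimes> h)" using \<Phi>[of "g \<otimes> h"] act_mult[of g h x0] g x0 by simp
    also have "\<dots> = ?H #> inv h #> inv g"
      using HG g h by (simp add: inv_mult_group coset_mult_assoc)
    finally show ?thesis using \<Phi>[of h] h by simp
  qed
  ultimately show ?thesis
    unfolding coset_space_iso_def homeomorphic_map_def by blast
qed

end

section \<open>Expansion of open sets\<close>

lemma space_borel_of_top: "space (borel_of_top T) = topspace T"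
  unfolding borel_of_top_def by (rule space_measure_of) (auto dest: openin_subset)

lemma sets_borel_of_top: "sets (borel_of_top T) = sigma_sets (topspace T) {U. openin T U}"
  unfolding borel_of_top_def by (rule sets_measure_of) (auto dest: openin_subset)

lemma openin_in_sets_borel_of_top: "openin T U \<Longrightarrow> U \<in> sets (borel_of_top T)"
  unfolding sets_borel_of_top by auto

lemma measurable_borel_of_topI:
  assumes "\<And>x. x \<in> space M \<Longrightarrow> f x \<in> topspace T"
    and "\<And>U. openin T U \<Longrightarrow> f -` U \<inter> space M \<in> sets M"
  shows "f \<in> measurable M (borel_of_top T)"
  unfolding borel_of_top_def using assms by (intro measurable_measure_of) (auto dest: openin_subset)

lemma continuous_map_measurable_borel_of_top:
  assumes "continuous_map S T f"
  shows "f \<in> measurable (borel_of_top S) (borel_of_top T)"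
proof (rule measurable_borel_of_topI)
  show "f x \<in> topspace T" if "x \<in> space (borel_of_top S)" for x
    using that continuous_map_image_subset_topspace[OF assms] unfolding space_borel_of_top by blast
  fix U assume "openin T U"
  then have "openin S {x \<in> topspace S. f x \<in> U}" using assms by (rule openin_continuous_map_preimage[rotated])
  moreover have "f -` U \<inter> space (borel_of_top S) = {x \<in> topspace S. f x \<in> U}"
    unfolding space_borel_of_top by blast
  ultimately show "f -` U \<inter> space (borel_of_top S) \<in> sets (borel_of_top S)"
    by (simp add: openin_in_sets_borel_of_top)
qed

lemma continuous_map_euclidean_borel_measurable:
  fixes f :: "'a \<Rightarrow> real"
  assumes "continuous_map S euclidean f"
  shows "f \<in> borel_measurable (borel_of_top S)"
proof (rule borel_measurableI)
  fix U :: "real set" assume "open U"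
  then have "openin S {x \<in> topspace S. f x \<in> U}"
    using assms by (intro openin_continuous_map_preimage) auto
  moreover have "f -` U \<inter> space (borel_of_top S) = {x \<in> topspace S. f x \<in> U}"
    unfolding space_borel_of_top by blast
  ultimately show "f -` U \<inter> space (borel_of_top S) \<in> sets (borel_of_top S)"
    by (simp add: openin_in_sets_borel_of_top)
qed

text \<open>Only one factor needs a countable base: group the boxes inside \<open>W\<close> by their first side.\<close>
lemma openin_prod_in_sets_pair:
  assumes "second_countable S" and W: "openin (prod_topology S T) W"
  shows "W \<in> sets (borel_of_top S \<Otimes>\<^sub>M borel_of_top T)"
proof -
  obtain \<B> where \<B>: "countable \<B>" "\<And>V. V \<in> \<B> \<Longrightarrow> openin S V"
    and base: "\<And>U x. openin S U \<Longrightarrow> x \<in> U \<Longrightarrow> \<exists>V\<in>\<B>. x \<in> V \<and> V \<subseteq> U"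
    using assms(1) unfolding second_countable_def by auto
  let ?R = "\<lambda>V. \<Union>{U. openin T U \<and> V \<times> U \<subseteq> W}"
  have "(x, y) \<in> (\<Union>V\<in>\<B>. V \<times> ?R V)" if xy: "(x, y) \<in> W" for x y
  proof -
    have "(x, y) \<in> W \<longrightarrow> (\<exists>U V. openin S U \<and> openin T V \<and> x \<in> U \<and> y \<in> V \<and> U \<times> V \<subseteq> W)"
      using W unfolding openin_prod_topology_alt by (elim allE)
    then obtain U V where UV: "openin S U" "openin T V" "x \<in> U" "y \<in> V" "U \<times> V \<subseteq> W"
      using xy by (elim impE exE conjE)
    then obtain B where "B \<in> \<B>" "x \<in> B" "B \<subseteq> U" using base[of U x] by blast
    moreover have "B \<times> V \<subseteq> W" using UV(5) \<open>B \<subseteq> U\<close> by blast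
    ultimately show ?thesis using UV by blast
  qed
  then have "W = (\<Union>V\<in>\<B>. V \<times> ?R V)" by (intro subset_antisym subrelI) blast+
  moreover have "V \<times> ?R V \<in> sets (borel_of_top S \<Otimes>\<^sub>M borel_of_top T)" if "V \<in> \<B>" for V
  proof -
    have "openin T (?R V)" by (rule openin_Union) blast
    then show ?thesis using \<B>(2)[OF that] by (intro pair_measureI openin_in_sets_borel_of_top)
  qed
  then have "(\<Union>V\<in>\<B>. V \<times> ?R V) \<in> sets (borel_of_top S \<Otimes>\<^sub>M borel_of_top T)"
    using \<B>(1) by (intro sets.countable_UN') auto
  ultimately show ?thesis by simp
qed

text \<open>Finitely many translates of a null open set cover any compact set, so all compact sets
  are null, and inner regularity on the whole group gives \<open>\<nu> = 0\<close>.\<close>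

lemma (in topological_group) haar_measure_open_pos:
  assumes haar: "haar_measure G TG \<nu>" and U: "openin TG U" "U \<noteq> {}"
  shows "emeasure \<nu> U > 0"
proof (rule ccontr)
  assume "\<not> emeasure \<nu> U > 0"
  then have U0: "emeasure \<nu> U = 0" by simp
  have UG: "U \<subseteq> carrier G" using U openin_subset_carrier by blast
  have sets: "W \<in> sets \<nu>" if "openin TG W" for W
    using haar openin_in_sets_borel_of_top[OF that] unfolding haar_measure_def by simp
  obtain u where u: "u \<in> U" "u \<in> carrier G" using U(2) UG by blast
  have K0: "emeasure \<nu> K = 0" if K: "compactin TG K" for K
  proof -
    have KG: "K \<subseteq> carrier G" using compactin_subset_topspace[OF K] by simp
    let ?T = "\<lambda>g. l_coset G (g \<otimes> inv u) U"
    have "\<exists>\<F>. finite \<F> \<and> \<F> \<subseteq> ?T ` K \<and> K \<subseteq> \<Union>\<F>"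
    proof (rule compactinD[OF K])
      show "openin TG W" if "W \<in> ?T ` K" for W
        using that KG U(1) u openin_l_coset by auto
      show "K \<subseteq> \<Union>(?T ` K)"
      proof
        fix g assume g: "g \<in> K"
        then have "g = g \<otimes> inv u \<otimes> u" using KG u by (auto simp: m_assoc)
        then have "g \<in> ?T g" using u unfolding l_coset_def by blast
        then show "g \<in> \<Union>(?T ` K)" using g by blast
      qed
    qed
    then obtain \<F> where \<F>: "finite \<F>" "\<F> \<subseteq> ?T ` K" "K \<subseteq> \<Union>\<F>" by (elim exE conjE)
    obtain I where I: "finite I" "I \<subseteq> K" "K \<subseteq> \<Union>(?T ` I)"
      using finite_subset_image[OF \<F>(1,2)] \<F>(3) by (elim exE conjE) simp
    have T0: "?T g \<in> null_sets \<nu>" if "g \<in> I" for g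
    proof -
      have g: "g \<otimes> inv u \<in> carrier G" using that I(2) KG u by auto
      have eq: "?T g = (\<lambda>x. g \<otimes> inv u \<otimes> x) ` U" unfolding l_coset_def by auto
      have "emeasure \<nu> ((\<lambda>x. g \<otimes> inv u \<otimes> x) ` U) = emeasure \<nu> U"
        using haar g sets[OF U(1)] unfolding haar_measure_def by blast
      then show ?thesis using U0 sets[OF openin_l_coset[OF g U(1)]] unfolding eq by auto
    qed
    have "(\<Union>g\<in>I. ?T g) \<in> null_sets \<nu>" using I(1) T0 by (intro null_sets.finite_UN) auto
    then have "emeasure \<nu> (\<Union>g\<in>I. ?T g) = 0" by auto
    moreover have "emeasure \<nu> K \<le> emeasure \<nu> (\<Union>g\<in>I. ?T g)"
      using I(1,2,3) KG u U(1) by (intro emeasure_mono sets openin_Union) (auto intro!: openin_l_coset)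
    ultimately show ?thesis by simp
  qed
  have "emeasure \<nu> (topspace TG) = (SUP K\<in>{K. compactin TG K \<and> K \<subseteq> topspace TG}. emeasure \<nu> K)"
    using haar openin_topspace[of TG] unfolding haar_measure_def by blast
  also have "\<dots> \<le> 0" using K0 by (intro SUP_least) auto
  finally have "emeasure \<nu> (carrier G) = 0" by simp
  moreover have "space \<nu> = carrier G" using haar unfolding haar_measure_def by simp
  moreover have "emeasure \<nu> (space \<nu>) \<noteq> 0" using haar unfolding haar_measure_def by (elim conjE)
  ultimately show False by simp
qed

lemma geometric_unbounded:
  fixes \<kappa> s T :: real
  assumes "\<kappa> > 0" "s > 1" "\<And>k. \<kappa> * s ^ k \<le> T"
  shows False
proof -
  obtain k where "T / \<kappa> < s ^ k" using real_arch_pow[OF assms(2)] by blast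
  then show False using assms(3)[of k] assms(1) by (simp add: field_simps)
qed

section \<open>Invariant probability measures and the gain of measure under
  \<open>sweep\<close>\<close>

locale measured_action = topological_action G TG TX act
  for G :: "('g, 'z) monoid_scheme" (structure) and TG :: "'g topology"
    and TX :: "'x topology" and act :: "'g \<Rightarrow> 'x \<Rightarrow> 'x" +
  fixes \<mu> :: "'x measure"
  assumes prob: "prob_space \<mu>"
    and space_\<mu>: "space \<mu> = topspace TX" and sets_\<mu>: "sets \<mu> = sets (borel_of_top TX)"
    and invariant: "invariant_measure G act \<mu>"
    and support: "full_support TX \<mu>"
begin

sublocale prob_space \<mu> by (rule prob)

lemma openin_sets_\<mu>: "openin TX U \<Longrightarrow> U \<in> sets \<mu>"
  unfolding sets_\<mu> by (rule openin_in_sets_borel_of_top)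

lemma measure_open_pos:
  assumes "openin TX U" "U \<noteq> {}" shows "measure \<mu> U > 0"
  using support assms unfolding full_support_def by (auto simp: emeasure_eq_measure)

lemma measurable_act:
  assumes "g \<in> carrier G" shows "act g \<in> measurable \<mu> \<mu>"
proof -
  have "continuous_map TX TX (\<lambda>x. act g x)" using assms by (intro continuous_act_comp) auto
  then show ?thesis
    using continuous_map_measurable_borel_of_top measurable_cong_sets[OF sets_\<mu> sets_\<mu>] by blast
qed

lemma distr_act:
  assumes "g \<in> carrier G" shows "distr \<mu> \<mu> (act g) = \<mu>"
  using assms invariant measurable_act[OF assms] unfolding invariant_measure_def
  by (intro measure_eqI) (auto simp: emeasure_distr)

lemma measure_act_image:
  assumes g: "g \<in> carrier G" and E: "openin TX E"
  shows "measure \<mu> (act g ` E) = measure \<mu> E"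
proof -
  have "act g ` E = act (inv g) -` E \<inter> space \<mu>"
    using act_image_eq_vimage[OF g openin_subset[OF E]] unfolding space_\<mu> by blast
  then show ?thesis
    using invariant g openin_sets_\<mu>[OF E] unfolding invariant_measure_def by (simp add: measure_def)
qed

text \<open>Continuity only makes preimages open in the product topology; the countable base of
  \<open>TG\<close> puts them into the product sigma-algebra, where Tonelli applies.\<close>

lemma measurable_inverse_act:
  assumes "second_countable TG" and sets: "sets \<nu> = sets (borel_of_top TG)"
  shows "(\<lambda>(g, x). act (inv g) x) \<in> measurable (\<nu> \<Otimes>\<^sub>M \<mu>) \<mu>"
proof -
  have space: "space \<nu> = carrier G"
    using sets_eq_imp_space_eq[OF sets] by (simp add: space_borel_of_top)
  have cont: "continuous_map (prod_topology TG TX) TX (\<lambda>z. act (inv (fst z)) (snd z))"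
    by (intro continuous_act_comp continuous_inv_comp continuous_map_fst continuous_map_snd)
  have "(\<lambda>z. act (inv (fst z)) (snd z)) \<in> measurable (\<nu> \<Otimes>\<^sub>M \<mu>) (borel_of_top TX)"
  proof (rule measurable_borel_of_topI)
    show "act (inv (fst z)) (snd z) \<in> topspace TX" if "z \<in> space (\<nu> \<Otimes>\<^sub>M \<mu>)" for z
      using that act_closed by (auto simp: space_pair_measure space space_\<mu>)
    fix U assume "openin TX U"
    then have "openin (prod_topology TG TX) {z \<in> topspace (prod_topology TG TX). act (inv (fst z)) (snd z) \<in> U}"
      by (rule openin_continuous_map_preimage[OF cont])
    then have "{z \<in> topspace (prod_topology TG TX). act (inv (fst z)) (snd z) \<in> U} \<in> sets (\<nu> \<Otimes>\<^sub>M \<mu>)"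
      using openin_prod_in_sets_pair[OF assms(1)] sets_pair_measure_cong[OF sets sets_\<mu>] by blast
    moreover have "{z \<in> topspace (prod_topology TG TX). act (inv (fst z)) (snd z) \<in> U} =
        (\<lambda>z. act (inv (fst z)) (snd z)) -` U \<inter> space (\<nu> \<Otimes>\<^sub>M \<mu>)"
      by (auto simp: space_pair_measure space space_\<mu>)
    ultimately show "(\<lambda>z. act (inv (fst z)) (snd z)) -` U \<inter> space (\<nu> \<Otimes>\<^sub>M \<mu>) \<in> sets (\<nu> \<Otimes>\<^sub>M \<mu>)"
      by simp
  qed
  then show ?thesis
    using measurable_cong_sets[OF refl sets_\<mu>, of "\<nu> \<Otimes>\<^sub>M \<mu>"] by (simp add: case_prod_beta')
qed

text \<open>By Tonelli and invariance, the integral over \<open>x\<close> is the total mass of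
  \<open>\<rho>\<close> times the integral of \<open>F\<close>. The purpose is to know where
  \<open>convolution_act\<close> is a genuine integral: a Bochner integral is \<open>0\<close> by
  default when the integrand is not integrable, which would spoil every lower bound.\<close>

lemma AE_finite_convolution:
  assumes "second_countable TG" and sets: "sets \<rho> = sets (borel_of_top TG)" and fin: "finite_measure \<rho>"
    and F: "F \<in> borel_measurable \<mu>" "(\<integral>\<^sup>+x. F x \<partial>\<mu>) \<noteq> (\<infinity>::ennreal)"
  shows "AE x in \<mu>. (\<integral>\<^sup>+g. F (act (inv g) x) \<partial>\<rho>) \<noteq> \<infinity>"
proof -
  interpret \<rho>: finite_measure \<rho> by fact
  interpret pair_sigma_finite \<rho> \<mu> ..
  have space: "space \<rho> = carrier G"
    using sets_eq_imp_space_eq[OF sets] by (simp add: space_borel_of_top)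
  have meas [measurable]: "(\<lambda>(g, x). F (act (inv g) x)) \<in> borel_measurable (\<rho> \<Otimes>\<^sub>M \<mu>)"
    using measurable_compose[OF measurable_inverse_act[OF assms(1) sets] F(1)] by (simp add: case_prod_beta')
  have "(\<integral>\<^sup>+x. (\<integral>\<^sup>+g. F (act (inv g) x) \<partial>\<rho>) \<partial>\<mu>) = (\<integral>\<^sup>+g. (\<integral>\<^sup>+x. F (act (inv g) x) \<partial>\<mu>) \<partial>\<rho>)"
    by (rule Fubini'[OF meas])
  also have "\<dots> = (\<integral>\<^sup>+g. (\<integral>\<^sup>+x. F x \<partial>\<mu>) \<partial>\<rho>)"
  proof (rule nn_integral_cong)
    fix g assume "g \<in> space \<rho>"
    then have g: "inv g \<in> carrier G" by (simp add: space)
    have "(\<integral>\<^sup>+x. F x \<partial>\<mu>) = (\<integral>\<^sup>+x. F x \<partial>distr \<mu> \<mu> (act (inv g)))" by (simp add: distr_act[OF g])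
    also have "\<dots> = (\<integral>\<^sup>+x. F (act (inv g) x) \<partial>\<mu>)"
      using F(1) measurable_act[OF g] by (simp add: nn_integral_distr)
    finally show "(\<integral>\<^sup>+x. F (act (inv g) x) \<partial>\<mu>) = (\<integral>\<^sup>+x. F x \<partial>\<mu>)" ..
  qed
  also have "\<dots> \<noteq> \<infinity>" using F(2) by (simp add: ennreal_mult_eq_top_iff)
  finally have "(\<integral>\<^sup>+x. (\<integral>\<^sup>+g. F (act (inv g) x) \<partial>\<rho>) \<partial>\<mu>) \<noteq> \<infinity>" .
  moreover have "(\<lambda>x. \<integral>\<^sup>+g. F (act (inv g) x) \<partial>\<rho>) \<in> borel_measurable \<mu>"
    using measurable_pair_swap[OF meas] by (intro \<rho>.borel_measurable_nn_integral) simp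
  ultimately show ?thesis by (intro nn_integral_PInf_AE)
qed

text \<open>Otherwise pick \<open>E k\<close> violating the bound with constant \<open>4 ^ k\<close>; then
  \<open>F = (\<Sum>k. 2 ^ -k / \<mu> (B E k) \<cdot> 1 on B E k)\<close> is integrable, so \<open>F powr (1 / p)\<close> lies in \<open>L\<^sup>p\<close>, but its
  convolution is too large on \<open>g\<^sub>0 E k\<close> to lie in \<open>L\<^sup>q\<close>.\<close>
lemma sobolev_expansion:
  assumes sc: "second_countable TG" and sob: "qualitative_sobolev G TG act \<mu>"
    and B: "openin TG B" "\<one> \<in> B"
  obtains r C :: real where "0 \<le> r" "r < 1" "0 < C"
    "\<And>E. openin TX E \<Longrightarrow> E \<noteq> {} \<Longrightarrow> measure \<mu> E powr r \<le> C * measure \<mu> (sweep B E)"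
proof -
  note witness = that
  obtain p q \<nu> \<phi> where *: "1 \<le> p \<and> p < q \<and> haar_measure G TG \<nu> \<and>
        continuous_map TG euclideanreal \<phi> \<and> (\<forall>g \<in> carrier G. 0 \<le> \<phi> g) \<and>
        in_Lp \<nu> 1 \<phi> \<and> (\<exists>g \<in> carrier G. \<phi> g \<noteq> 0) \<and>
        (\<forall>f. in_Lp \<mu> p f \<longrightarrow> in_Lp_ae \<mu> q (convolution_act G \<nu> act \<phi> f))"
    using sob unfolding qualitative_sobolev_def by (elim exE)
  then have "1 \<le> p" "p < q" and haar: "haar_measure G TG \<nu>"
    and cont: "continuous_map TG euclideanreal \<phi>" and nonneg: "\<forall>g\<in>carrier G. 0 \<le> \<phi> g"
    and L1: "in_Lp \<nu> 1 \<phi>" and ex: "\<exists>g\<in>carrier G. \<phi> g \<noteq> 0"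
    and emb: "\<forall>f. in_Lp \<mu> p f \<longrightarrow> in_Lp_ae \<mu> q (convolution_act G \<nu> act \<phi> f)"
    by - (elim conjE; assumption)+
  obtain g0 where g0: "g0 \<in> carrier G" "0 < \<phi> g0" using ex nonneg by force
  have sets_\<nu>: "sets \<nu> = sets (borel_of_top TG)" and space_\<nu>: "space \<nu> = carrier G"
    using haar unfolding haar_measure_def by auto
  have BG: "B \<subseteq> carrier G" using B openin_subset_carrier by blast
  have p_fin: "p \<noteq> \<infinity>" using \<open>p < q\<close> by auto
  define P where "P = enn2real p"
  have p: "p = ennreal P" "1 \<le> P"
    using p_fin \<open>1 \<le> p\<close> unfolding P_def by (auto simp: enn2real_positive_iff le_ennreal_iff top.not_eq_extremum
      intro: enn2real_leI dest: enn2real_mono)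
  \<comment> \<open>For infinite \<open>q\<close> the exponent is \<open>0\<close>, and the claim
    becomes a positive lower bound for the measure of \<open>sweep B E\<close>.\<close>
  define r where "r = (if q = \<infinity> then 0 else P / enn2real q)"
  have PQ: "P < enn2real q" if "q \<noteq> \<infinity>"
    using \<open>p < q\<close> that unfolding P_def by (intro enn2real_less_iff[THEN iffD2]) (auto simp: top.not_eq_extremum)
  have r: "0 \<le> r" "r < 1" using PQ p(2) unfolding r_def by auto
  define c where "c = \<phi> g0 / 2"
  \<comment> \<open>For \<open>g\<close> in \<open>N\<close> and \<open>x = act g0 e\<close> with
    \<open>e\<close> in \<open>E\<close>, the point \<open>act (inv g) x\<close> lies in
    \<open>sweep B E\<close>, while \<open>\<phi> g\<close> is at least half of
    \<open>\<phi> g0\<close>. So the convolution at \<open>x\<close> collects a fixed proportion of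
    the values on \<open>sweep B E\<close>.\<close>
  define N where "N = {g \<in> carrier G. \<phi> g \<in> {c<..}} \<inter> {g \<in> carrier G. inv g \<otimes> g0 \<in> B}"
  have N: "openin TG N"
    unfolding N_def
  proof (rule openin_Int)
    show "openin TG {g \<in> carrier G. \<phi> g \<in> {c<..}}"
      using openin_continuous_map_preimage[OF cont, of "{c<..}"] by simp
    show "openin TG {g \<in> carrier G. inv g \<otimes> g0 \<in> B}"
      using g0 B by (intro openin_vimage continuous_mult_comp continuous_inv) auto
  qed
  have "g0 \<in> N" using g0 B unfolding N_def c_def by simp
  then have "emeasure \<nu> N > 0" using haar_measure_open_pos[OF haar N] by blast
  \<comment> \<open>Cutting off at \<open>1\<close> gives a positive real lower bound for
    \<open>\<nu> N\<close> without an estimate of \<open>\<nu> N\<close> from above.\<close>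
  define m where "m = enn2real (min (emeasure \<nu> N) 1)"
  have "min (emeasure \<nu> N) 1 < \<top>" by (simp add: min_less_iff_disj)
  then have "ennreal m = min (emeasure \<nu> N) 1" "m > 0"
    using \<open>emeasure \<nu> N > 0\<close> unfolding m_def by (simp_all add: enn2real_positive_iff)
  then have m: "m > 0" "ennreal m \<le> emeasure \<nu> N" by simp_all
  have c: "c > 0" using g0 unfolding c_def by simp
  have \<phi>_meas [measurable]: "\<phi> \<in> borel_measurable \<nu>"
    using continuous_map_euclidean_borel_measurable[OF cont] measurable_cong_sets[OF sets_\<nu> refl] by blast
  \<comment> \<open>Tonelli wants a sigma-finite measure; \<open>\<rho>\<close> is even finite, its
    mass being the integral of \<open>\<phi>\<close>.\<close>
  define \<rho> where "\<rho> = density \<nu> (\<lambda>g. ennreal (\<phi> g))"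
  have \<rho>_fin: "finite_measure \<rho>"
  proof
    have "emeasure \<rho> (space \<rho>) = (\<integral>\<^sup>+g. ennreal (\<phi> g) \<partial>\<nu>)"
      unfolding \<rho>_def by (subst emeasure_density) (auto intro!: nn_integral_cong)
    also have "\<dots> = (\<integral>\<^sup>+g. ennreal (\<bar>\<phi> g\<bar> powr enn2real 1) \<partial>\<nu>)"
      using nonneg by (intro nn_integral_cong) (auto simp: space_\<nu>)
    also have "\<dots> < \<infinity>" using L1 unfolding in_Lp_def by simp
    finally show "emeasure \<rho> (space \<rho>) \<noteq> \<infinity>" by simp
  qed
  interpret \<rho>: finite_measure \<rho> by fact
  have sets_\<rho>: "sets \<rho> = sets (borel_of_top TG)" unfolding \<rho>_def by (simp add: sets_\<nu>)
  show thesis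
  proof (rule ccontr)
    assume "\<not> thesis"
    then have "\<exists>E. openin TX E \<and> E \<noteq> {} \<and> C * measure \<mu> (sweep B E) < measure \<mu> E powr r" if "C > 0" for C
      using witness[of r C] r that by force
    \<comment> \<open>Of the factor \<open>4 ^ k\<close>, one \<open>2 ^ k\<close> pays for the
      summable weights in \<open>d\<close>, and the other is the growth that gives the
      contradiction: \<open>d k * (4 ^ k * a k) = 2 ^ k\<close>.\<close>
    then have "\<forall>k. \<exists>E. openin TX E \<and> E \<noteq> {} \<and> 4 ^ k * measure \<mu> (sweep B E) < measure \<mu> E powr r" by simp
    then obtain E where E: "\<And>k. openin TX (E k)" "\<And>k. E k \<noteq> {}"
      and small: "\<And>k. 4 ^ k * measure \<mu> (sweep B (E k)) < measure \<mu> (E k) powr r" by metis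
    define A where "A k = sweep B (E k)" for k
    define a where "a k = measure \<mu> (A k)" for k
    define d where "d k = 1 / 2 ^ k / a k" for k
    have A: "openin TX (A k)" for k unfolding A_def using E(1) BG by (rule openin_sweep[rotated])
    have [measurable]: "A k \<in> sets \<mu>" for k using A openin_sets_\<mu> by blast
    have "A k \<noteq> {}" for k
      using sweep_superset[OF B(2), of "E k"] E(2)[of k] openin_subset[OF E(1)] unfolding A_def by blast
    then have a: "a k > 0" for k unfolding a_def using A measure_open_pos by blast
    then have d: "d k > 0" for k unfolding d_def by simp
    define F where "F x = (\<Sum>k. ennreal (d k) * indicator (A k) x)" for x
    have F_meas [measurable]: "F \<in> borel_measurable \<mu>" unfolding F_def by measurable
    have "(\<integral>\<^sup>+x. F x \<partial>\<mu>) = (\<Sum>k. ennreal (d k) * emeasure \<mu> (A k))"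
      unfolding F_def by (subst nn_integral_suminf) (auto simp: nn_integral_cmult)
    also have "\<dots> = (\<Sum>k. ennreal ((1 / 2) ^ k))"
    proof (intro suminf_cong)
      fix k
      show "ennreal (d k) * emeasure \<mu> (A k) = ennreal ((1 / 2) ^ k)"
        using a[of k] d[of k] unfolding emeasure_eq_measure a_def[symmetric]
        by (simp add: d_def ennreal_mult[symmetric] power_divide)
    qed
    also have "\<dots> = ennreal (\<Sum>k. (1 / 2) ^ k)"
      by (intro suminf_ennreal2 summable_geometric) auto
    finally have F_int: "(\<integral>\<^sup>+x. F x \<partial>\<mu>) \<noteq> \<infinity>" by simp
    have F_ge: "ennreal (d k) \<le> F x" if "x \<in> A k" for k x
    proof -
      have "ennreal (d k) = (\<Sum>j\<in>{k}. ennreal (d j) * indicator (A j) x)"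
        using that by (subst sum.insert) auto
      also have "\<dots> \<le> F x" unfolding F_def by (rule sum_le_suminf) auto
      finally show ?thesis .
    qed
    \<comment> \<open>\<open>enn2real\<close> sends infinite values of \<open>F\<close> to
      \<open>0\<close>, so lower bounds for \<open>f\<close> are available only where
      \<open>F\<close> is finite.\<close>
    define f where "f x = enn2real (F x) powr (1 / P)" for x
    have f_meas [measurable]: "f \<in> borel_measurable \<mu>" unfolding f_def by measurable
    \<comment> \<open>Since \<open>t powr (1 / P) \<le> 1 + t\<close>, finiteness of the convolution
      of \<open>F\<close> passes to that of \<open>f\<close>.\<close>
    have f_le: "ennreal (f x) \<le> 1 + F x" for x
    proof (cases "F x = \<infinity>")
      case False
      let ?y = "enn2real (F x)"
      have "?y powr (1 / P) \<le> 1 + ?y"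
      proof (cases "?y \<le> 1")
        case True
        then have "?y powr (1 / P) \<le> 1" using p(2) by (intro powr_le1) auto
        then show ?thesis using enn2real_nonneg[of "F x"] by linarith
      next
        case False
        then have "?y powr (1 / P) \<le> ?y powr 1" using p(2) by (intro powr_mono) auto
        then show ?thesis using False by simp
      qed
      then have "ennreal (f x) \<le> ennreal (1 + ?y)" unfolding f_def by (rule ennreal_leI)
      also have "\<dots> = 1 + F x" using False by (simp add: ennreal_plus less_top[symmetric])
      finally show ?thesis .
    qed simp
    have "in_Lp \<mu> p f"
    proof -
      have "(\<integral>\<^sup>+x. ennreal (\<bar>f x\<bar> powr P) \<partial>\<mu>) \<le> (\<integral>\<^sup>+x. F x \<partial>\<mu>)"
      proof (rule nn_integral_mono)
        fix x
        have "\<bar>f x\<bar> powr P = enn2real (F x)" using p(2) by (simp add: f_def powr_powr)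
        then show "ennreal (\<bar>f x\<bar> powr P) \<le> F x"
          by (cases "F x = \<infinity>") (auto simp: less_top[symmetric])
      qed
      then have "(\<integral>\<^sup>+x. ennreal (\<bar>f x\<bar> powr P) \<partial>\<mu>) < \<infinity>"
        using F_int by (simp add: less_top order_le_less_trans)
      then show ?thesis using p_fin unfolding in_Lp_def P_def[symmetric] by simp
    qed
    then obtain h where h: "in_Lp \<mu> q h" and ae_h: "AE x in \<mu>. convolution_act G \<nu> act \<phi> f x = h x"
      using emb unfolding in_Lp_ae_def by blast
    have [measurable]: "h \<in> borel_measurable \<mu>" using h unfolding in_Lp_def by blast
    define \<kappa> where "\<kappa> = c * m"
    have \<kappa>: "\<kappa> > 0" unfolding \<kappa>_def using c m by simp
    define S where "S k = act g0 ` E k" for k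
    have S: "openin TX (S k)" "measure \<mu> (S k) = measure \<mu> (E k)" for k
      unfolding S_def using openin_act_image measure_act_image E(1) g0(1) by auto
    have [measurable]: "S k \<in> sets \<mu>" for k using S openin_sets_\<mu> by blast
    \<comment> \<open>Outside one null set, common to all \<open>k\<close>, the convolution is an
      integral of a nonnegative integrable function and may be bounded below by its part over
      \<open>N\<close>.\<close>
    have lower: "AE x in \<mu>. \<forall>k. x \<in> S k \<longrightarrow> \<kappa> * d k powr (1 / P) \<le> h x"
      using AE_finite_convolution[OF sc sets_\<rho> \<rho>_fin F_meas F_int] ae_h AE_space
    proof eventually_elim
      case (elim x)
      then have x: "x \<in> topspace TX" by (simp add: space_\<mu>)
      let ?y = "\<lambda>g. act (inv g) x"
      have y_meas: "?y \<in> measurable \<nu> \<mu>"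
      proof -
        have "continuous_map TG TX ?y"
          using x by (intro continuous_act_comp continuous_inv) auto
        then show ?thesis
          using continuous_map_measurable_borel_of_top measurable_cong_sets[OF sets_\<nu> sets_\<mu>] by blast
      qed
      have fy [measurable]: "(\<lambda>g. f (?y g)) \<in> borel_measurable \<nu>"
        and Fy [measurable]: "(\<lambda>g. F (?y g)) \<in> borel_measurable \<nu>"
        using measurable_compose[OF y_meas] f_meas F_meas by blast+
      have Fy_\<rho>: "(\<lambda>g. F (?y g)) \<in> borel_measurable \<rho>" unfolding \<rho>_def by measurable
      let ?u = "\<lambda>g. \<phi> g * f (?y g)"
      have u_nonneg: "0 \<le> ?u g" if "g \<in> space \<nu>" for g
        using nonneg that unfolding f_def space_\<nu> by simp
      have u_eq: "(\<integral>\<^sup>+g. ennreal (?u g) \<partial>\<nu>) = (\<integral>\<^sup>+g. ennreal (f (?y g)) \<partial>\<rho>)"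
        unfolding \<rho>_def using nonneg
        by (subst nn_integral_density) (auto intro!: nn_integral_cong simp: space_\<nu> ennreal_mult' )
      also have "\<dots> \<le> (\<integral>\<^sup>+g. 1 + F (?y g) \<partial>\<rho>)" by (intro nn_integral_mono f_le)
      also have "\<dots> = emeasure \<rho> (space \<rho>) + (\<integral>\<^sup>+g. F (?y g) \<partial>\<rho>)"
        using Fy_\<rho> by (subst nn_integral_add) auto
      also have "\<dots> < \<infinity>" using elim(1) \<rho>.emeasure_finite[of "space \<rho>"] by (auto simp: less_top[symmetric])
      finally have "(\<integral>\<^sup>+g. ennreal (?u g) \<partial>\<nu>) < \<infinity>" .
      then have "integrable \<nu> ?u"
        using u_nonneg by (intro integrableI_nonneg) auto
      then have conv: "(\<integral>\<^sup>+g. ennreal (?u g) \<partial>\<nu>) = ennreal (h x)"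
        using nn_integral_eq_integral[of \<nu> ?u] u_nonneg elim(2) unfolding convolution_act_def by auto
      \<comment> \<open>Finiteness of the \<open>\<rho>\<close>-integral controls \<open>F\<close>
        only where \<open>\<phi>\<close> is positive, and \<open>N\<close> lies in that
        region.\<close>
      have F_fin: "AE g in \<nu>. 0 < \<phi> g \<longrightarrow> F (?y g) \<noteq> \<infinity>"
        using nn_integral_PInf_AE[OF Fy_\<rho> elim(1)] unfolding \<rho>_def by (subst (asm) AE_density) auto
      have N_sets: "N \<in> sets \<nu>" using N openin_in_sets_borel_of_top unfolding sets_\<nu> by blast
      show ?case
      proof (intro allI impI)
        fix k assume "x \<in> S k"
        then obtain e where e: "e \<in> E k" "x = act g0 e" unfolding S_def by blast
        have eX: "e \<in> topspace TX" using e openin_subset[OF E(1)] by blast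
        have yA: "?y g \<in> A k" if "g \<in> N" for g
        proof -
          have g: "g \<in> carrier G" "inv g \<otimes> g0 \<in> B" using that unfolding N_def by auto
          then have "?y g = act (inv g \<otimes> g0) e" using e eX act_mult[of "inv g" g0 e] g0 by simp
          then show ?thesis unfolding A_def sweep_def using g e by blast
        qed
        have "AE g in \<nu>. ennreal (c * d k powr (1 / P)) * indicator N g \<le> ennreal (?u g)"
          using F_fin AE_space
        proof eventually_elim
          case (elim g)
          show ?case
          proof (cases "g \<in> N")
            case True
            then have g: "\<phi> g > c" unfolding N_def by auto
            then have "F (?y g) \<noteq> \<infinity>" using elim c by auto
            then have "d k \<le> enn2real (F (?y g))"
              using F_ge[OF yA[OF True]] d[of k] by (metis enn2real_ennreal enn2real_mono less_eq_real_def less_top infinity_ennreal_def)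
            then have "d k powr (1 / P) \<le> f (?y g)"
              unfolding f_def using d[of k] p(2) by (intro powr_mono2) auto
            then have "c * d k powr (1 / P) \<le> ?u g" using g c by (intro mult_mono) auto
            then show ?thesis using True by (simp add: ennreal_leI)
          qed simp
        qed
        then have "(\<integral>\<^sup>+g. ennreal (c * d k powr (1 / P)) * indicator N g \<partial>\<nu>) \<le> ennreal (h x)"
          unfolding conv[symmetric] by (rule nn_integral_mono_AE)
        then have "ennreal (c * d k powr (1 / P)) * emeasure \<nu> N \<le> ennreal (h x)"
          using N_sets by (simp add: nn_integral_cmult)
        then have "ennreal (c * d k powr (1 / P)) * ennreal m \<le> ennreal (h x)"
          using mult_left_mono[OF m(2), of "ennreal (c * d k powr (1 / P))"] by (auto intro: order_trans)
        then have "ennreal (\<kappa> * d k powr (1 / P)) \<le> ennreal (h x)"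
          using c m by (simp add: ennreal_mult[symmetric] \<kappa>_def mult_ac)
        \<comment> \<open>\<open>ennreal\<close> truncates negative reals to \<open>0\<close>;
          positivity of the left side is what permits the return to a real inequality.\<close>
        moreover have "0 < \<kappa> * d k powr (1 / P)" using \<kappa> d[of k] by simp
        ultimately show "\<kappa> * d k powr (1 / P) \<le> h x"
          by (metis ennreal_le_iff2 not_le)
      qed
    qed
    have Ek: "measure \<mu> (E k) > 0" for k using E measure_open_pos by blast
    show False
    proof (cases "q = \<infinity>")
      case True
      then obtain C where C: "AE x in \<mu>. \<bar>h x\<bar> \<le> C" using h unfolding in_Lp_def by auto
      have "\<kappa> * (2 powr (1 / P)) ^ k \<le> C" for k
      proof -
        have "AE x in \<mu>. x \<in> S k \<longrightarrow> \<kappa> * d k powr (1 / P) \<le> C"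
          using lower C by eventually_elim (auto intro: order_trans)
        then have "\<kappa> * d k powr (1 / P) \<le> C"
        proof (rule contrapos_pp)
          assume "\<not> \<kappa> * d k powr (1 / P) \<le> C"
          moreover have "S k \<notin> null_sets \<mu>"
            using Ek[of k] S(2)[of k] by (auto simp: null_sets_def emeasure_eq_measure)
          ultimately show "\<not> (AE x in \<mu>. x \<in> S k \<longrightarrow> \<kappa> * d k powr (1 / P) \<le> C)"
            using AE_iff_null_sets[of "S k" \<mu>] by simp
        qed
        moreover have "2 ^ k \<le> d k"
          using small[of k] a[of k] Ek[of k] True
          unfolding d_def r_def A_def[symmetric] a_def[symmetric]
          by (simp add: field_simps power_mult_distrib[symmetric])
        \<comment> \<open>For \<open>r = 0\<close>, \<open>small\<close> reads
          \<open>4 ^ k * a k < 1\<close>, so the heights \<open>d k\<close> exceed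
          \<open>2 ^ k\<close> and \<open>h\<close> cannot be essentially bounded.\<close>
        then have "(2 ^ k) powr (1 / P) \<le> d k powr (1 / P)" using p(2) by (intro powr_mono2) auto
        then have "\<kappa> * (2 ^ k) powr (1 / P) \<le> \<kappa> * d k powr (1 / P)" using \<kappa> by simp
        moreover have "((2::real) ^ k) powr (1 / P) = (2 powr (1 / P)) ^ k"
          by (simp add: powr_realpow[symmetric] powr_powr mult.commute)
        ultimately show ?thesis by simp
      qed
      moreover have "(2::real) powr (1 / P) > 1" using p(2) by simp
      ultimately show False using \<kappa> geometric_unbounded by blast
    next
      case False
      define Q where "Q = enn2real q"
      have Q: "P < Q" "0 < Q" using PQ[OF False] p(2) unfolding Q_def by auto
      define T where "T = enn2real (\<integral>\<^sup>+x. ennreal (\<bar>h x\<bar> powr Q) \<partial>\<mu>)"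
      have T: "(\<integral>\<^sup>+x. ennreal (\<bar>h x\<bar> powr Q) \<partial>\<mu>) = ennreal T"
        using h False unfolding in_Lp_def T_def Q_def by simp
      \<comment> \<open>The integral of \<open>\<bar>h\<bar> powr Q\<close> is at least
        \<open>(\<kappa> * d k powr (1 / P)) powr Q\<close> times the measure of \<open>S k\<close>.
        Raising \<open>small\<close> to the power \<open>Q / P\<close> solves it for that measure,
        and the product grows geometrically in \<open>k\<close>.\<close>
      have "\<kappa> powr Q * (2 powr (Q / P)) ^ k \<le> T" for k
      proof -
        let ?v = "\<kappa> * d k powr (1 / P)"
        have v: "?v > 0" using \<kappa> d[of k] by simp
        have "AE x in \<mu>. ennreal (?v powr Q) * indicator (S k) x \<le> ennreal (\<bar>h x\<bar> powr Q)"
          using lower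
        proof eventually_elim
          case (elim x)
          show ?case
          proof (cases "x \<in> S k")
            case True
            then have "?v \<le> \<bar>h x\<bar>" using elim by (meson abs_ge_self order_trans)
            then have "?v powr Q \<le> \<bar>h x\<bar> powr Q" using v Q by (intro powr_mono2) auto
            then show ?thesis using True by (simp add: ennreal_leI)
          qed simp
        qed
        then have "(\<integral>\<^sup>+x. ennreal (?v powr Q) * indicator (S k) x \<partial>\<mu>) \<le> ennreal T"
          unfolding T[symmetric] by (rule nn_integral_mono_AE)
        then have "ennreal (?v powr Q * measure \<mu> (E k)) \<le> ennreal T"
          by (simp add: nn_integral_cmult emeasure_eq_measure S(2) ennreal_mult)
        then have le: "?v powr Q * measure \<mu> (E k) \<le> T"
          unfolding T_def by (simp add: ennreal_le_iff)
        have "4 ^ k * a k \<le> measure \<mu> (E k) powr (P / Q)"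
          using small[of k] False unfolding a_def A_def r_def Q_def by simp
        then have "(4 ^ k * a k) powr (Q / P) \<le> (measure \<mu> (E k) powr (P / Q)) powr (Q / P)"
          using a[of k] p(2) Q by (intro powr_mono2) auto
        also have "\<dots> = measure \<mu> (E k)" using Ek[of k] p(2) Q by (simp add: powr_powr)
        finally have ge: "(4 ^ k * a k) powr (Q / P) \<le> measure \<mu> (E k)" .
        have "?v powr Q = \<kappa> powr Q * d k powr (Q / P)"
          using \<kappa> d[of k] by (simp add: powr_mult powr_powr)
        then have "\<kappa> powr Q * (d k powr (Q / P) * (4 ^ k * a k) powr (Q / P)) \<le> ?v powr Q * measure \<mu> (E k)"
          using ge by (simp add: mult.assoc mult_left_mono)
        moreover have "d k powr (Q / P) * (4 ^ k * a k) powr (Q / P) = (2 powr (Q / P)) ^ k"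
        proof -
          have "d k * (4 ^ k * a k) = 2 ^ k"
            using a[of k] unfolding d_def by (simp add: field_simps power_mult_distrib[symmetric])
          then have "d k powr (Q / P) * (4 ^ k * a k) powr (Q / P) = (2 ^ k) powr (Q / P)"
            using a[of k] d[of k] by (simp add: powr_mult[symmetric])
          then show ?thesis by (simp add: powr_realpow[symmetric] powr_powr mult.commute)
        qed
        ultimately show ?thesis using le by simp
      qed
      moreover have "(2::real) powr (Q / P) > 1" using p(2) Q by simp
      ultimately show False
        using \<kappa> by (intro geometric_unbounded[of "\<kappa> powr Q" "2 powr (Q / P)" T]) auto
    qed
  qed
qed

end

section \<open>Iterated expansion in doubling groups\<close>

text \<open>\<open>B k\<close> is to be thought of as a ball of radius \<open>2 ^ -k\<close> about
  the identity, and \<open>V k\<close> as a ball containing all finite products \<open>B k\<close>,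
  \<open>B (k + 1)\<close>, ..., \<open>B n\<close>. The one-step inclusion \<open>B_mult_V\<close>
  encodes this without infinite products, and it suffices to enclose \<open>V 0\<close> in a compact
  set. \<open>M\<close> is the same at every scale.\<close>

locale doubling_group = topological_group +
  fixes B V :: "nat \<Rightarrow> 'g set" and K :: "'g set" and M :: nat
  assumes Hausdorff: "Hausdorff_space TG"
    and B_open: "openin TG (B k)" and B_one: "\<one> \<in> B k"
    and V_open: "openin TG (V k)" and V_one: "\<one> \<in> V k"
    and B_mult_V: "B k <#> V (Suc k) \<subseteq> V k"
    and V_subset_K: "V 0 \<subseteq> K" and K_compact: "compactin TG K"
    and doubling: "\<exists>F. finite F \<and> card F \<le> M \<and> F \<subseteq> carrier G \<and>
      B k \<subseteq> (\<Union>g\<in>F. l_coset G g (B (Suc k)))"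
    and B_base: "openin TG W \<Longrightarrow> \<one> \<in> W \<Longrightarrow> \<exists>k. B k \<subseteq> W"
begin

lemma B_carrier: "B k \<subseteq> carrier G" and V_carrier: "V k \<subseteq> carrier G"
  using B_open V_open openin_subset_carrier by auto

text \<open>Left translates compose: coverings of \<open>B 0\<close> by the \<open>g B k\<close> and
  of \<open>B k\<close> by the \<open>h B (Suc k)\<close> combine to one by the
  \<open>(g \<otimes> h) B (Suc k)\<close>, so the counts multiply.\<close>

lemma iterated_doubling:
  "\<exists>F. finite F \<and> card F \<le> M ^ k \<and> F \<subseteq> carrier G \<and> B 0 \<subseteq> (\<Union>g\<in>F. l_coset G g (B k))"
proof (induction k)
  case 0
  have "l_coset G \<one> (B 0) = B 0"
    using lcos_mult_one[OF B_carrier] .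
  then show ?case by (intro exI[of _ "{\<one>}"]) auto
next
  case (Suc k)
  then obtain F where F: "finite F" "card F \<le> M ^ k" "F \<subseteq> carrier G" "B 0 \<subseteq> (\<Union>g\<in>F. l_coset G g (B k))"
    by (elim exE conjE)
  obtain F' where F': "finite F'" "card F' \<le> M" "F' \<subseteq> carrier G" "B k \<subseteq> (\<Union>g\<in>F'. l_coset G g (B (Suc k)))"
    using doubling[of k] by (elim exE conjE)
  let ?H = "(\<lambda>(g, h). g \<otimes> h) ` (F \<times> F')"
  have "card ?H \<le> card F * card F'"
    using card_image_le[of "F \<times> F'" "\<lambda>(g, h). g \<otimes> h"] F(1) F'(1) by (simp add: card_cartesian_product)
  also have "\<dots> \<le> M ^ k * M" using F(2) F'(2) by (rule mult_le_mono)
  finally have "card ?H \<le> M ^ Suc k" by (simp add: mult.commute)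
  moreover have "B 0 \<subseteq> (\<Union>g\<in>?H. l_coset G g (B (Suc k)))"
  proof
    fix x assume "x \<in> B 0"
    then obtain g y where g: "g \<in> F" "y \<in> B k" "x = g \<otimes> y" using F(4) unfolding l_coset_def by blast
    then obtain h z where h: "h \<in> F'" "z \<in> B (Suc k)" "y = h \<otimes> z" using F'(4) unfolding l_coset_def by blast
    have "g \<in> carrier G" "h \<in> carrier G" "z \<in> carrier G" using g h F(3) F'(3) B_carrier by auto
    then have "x = g \<otimes> h \<otimes> z" using g h by (simp add: m_assoc)
    then have "x \<in> l_coset G (g \<otimes> h) (B (Suc k))" using h unfolding l_coset_def by blast
    moreover have "g \<otimes> h \<in> ?H" using g h by force
    ultimately show "x \<in> (\<Union>g\<in>?H. l_coset G g (B (Suc k)))" by blast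
  qed
  moreover have "?H \<subseteq> carrier G" using F(3) F'(3) by auto
  moreover have "finite ?H" using F(1) F'(1) by simp
  ultimately show ?case by blast
qed

text \<open>The centres of all the coverings of \<open>B 0\<close> are dense in it: if
  \<open>u = g \<otimes> b\<close> with \<open>b\<close> in \<open>B k\<close>, then
  \<open>g = u \<otimes> inv b\<close> is close to \<open>u\<close> for large
  \<open>k\<close>.\<close>

lemma second_countable_if_connected:
  assumes "connected_space TG"
  shows "second_countable TG"
proof -
  obtain F where F: "\<And>k. finite (F k)" "\<And>k. F k \<subseteq> carrier G" "\<And>k. B 0 \<subseteq> (\<Union>g\<in>F k. l_coset G g (B k))"
    using iterated_doubling by metis
  let ?D = "\<Union>k. F k"
  have D: "countable ?D" using F(1) by (intro countable_UN) (auto simp: countable_finite)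
  have closure: "B 0 \<subseteq> TG closure_of ?D"
  proof
    fix u assume u: "u \<in> B 0"
    then have uG: "u \<in> carrier G" using B_carrier by blast
    have "\<exists>y. y \<in> ?D \<and> y \<in> W" if W: "u \<in> W" "openin TG W" for W
    proof -
      have "openin TG {x \<in> carrier G. u \<otimes> inv x \<in> W}"
        using uG W by (intro openin_vimage continuous_mult_comp continuous_inv) auto
      then obtain k where k: "B k \<subseteq> {x \<in> carrier G. u \<otimes> inv x \<in> W}"
        using B_base[of "{x \<in> carrier G. u \<otimes> inv x \<in> W}"] uG W(1) by auto
      obtain g b where g: "g \<in> F k" "b \<in> B k" "u = g \<otimes> b"
        using F(3)[of k] u unfolding l_coset_def by blast
      then have "g \<in> carrier G" "b \<in> carrier G" using F(2) B_carrier by auto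
      then have "u \<otimes> inv b = g" using g(3) by (simp add: m_assoc)
      then have "g \<in> W" using k g(2) by auto
      then show ?thesis using g(1) by blast
    qed
    then show "u \<in> TG closure_of ?D" unfolding in_closure_of using uG by auto
  qed
  obtain \<Gamma> where "countable \<Gamma>" "\<Gamma> \<subseteq> carrier G" "TG closure_of \<Gamma> = carrier G"
    using countable_dense_if_connected[OF assms B_open B_one D UN_least[OF F(2)] closure] .
  then show ?thesis using B_open B_one B_base by (rule second_countable_if_dense)
qed

end

text \<open>A left translate of \<open>S'\<close> sweeps \<open>E\<close> to a translate of
  \<open>sweep S' E\<close>, which has the same measure by invariance, so only the number of
  translates counts. This carries the expansion from \<open>B 0\<close> to every
  \<open>B k\<close>.\<close>

lemma (in measured_action) measure_sweep_cover:
  assumes F: "finite F" "F \<subseteq> carrier G" "S \<subseteq> (\<Union>g\<in>F. l_coset G g S')" "S \<subseteq> carrier G" "S' \<subseteq> carrier G"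
    and E: "openin TX E"
  shows "measure \<mu> (sweep S E) \<le> card F * measure \<mu> (sweep S' E)"
proof -
  have EX: "E \<subseteq> topspace TX" using E openin_subset by blast
  have op: "openin TX (sweep S' E)" using F(5) E by (rule openin_sweep)
  have "sweep S E \<subseteq> (\<Union>g\<in>F. act g ` sweep S' E)"
  proof
    fix x assume "x \<in> sweep S E"
    then obtain s e where s: "s \<in> S" "e \<in> E" "x = act s e" unfolding sweep_def by blast
    then obtain g t where g: "g \<in> F" "t \<in> S'" "s = g \<otimes> t" using F(3) unfolding l_coset_def by blast
    have "x = act g (act t e)" using s g act_mult[of g t e] F(2,5) EX by (auto simp: subset_iff)
    moreover have "act t e \<in> sweep S' E" unfolding sweep_def using g s by blast
    ultimately show "x \<in> (\<Union>g\<in>F. act g ` sweep S' E)" using g by blast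
  qed
  then have "measure \<mu> (sweep S E) \<le> measure \<mu> (\<Union>g\<in>F. act g ` sweep S' E)"
    using F(2) openin_act_image[OF _ op] by (intro finite_measure_mono openin_sets_\<mu> openin_Union) auto
  also have "\<dots> \<le> (\<Sum>g\<in>F. measure \<mu> (act g ` sweep S' E))"
    using F(1,2) openin_act_image[OF _ op] openin_sets_\<mu> by (intro finite_measure_subadditive_finite) auto
  also have "\<dots> = (\<Sum>g\<in>F. measure \<mu> (sweep S' E))"
    using F(2) measure_act_image[OF _ op] by (intro sum.cong) auto
  finally show ?thesis by simp
qed

locale doubling_action = doubling_group G TG B V K M + measured_action G TG TX act \<mu>
  for G :: "('g, 'z) monoid_scheme" (structure) and TG :: "'g topology"
    and B V :: "nat \<Rightarrow> 'g set" and K :: "'g set" and M :: nat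
    and TX :: "'x topology" and act :: "'g \<Rightarrow> 'x \<Rightarrow> 'x" and \<mu> :: "'x measure"
begin

text \<open>The exponents \<open>\<alpha> k + \<beta>\<close> solve \<open>(k + 1) + r (\<alpha> (k + 1) + \<beta>) = \<alpha> k + \<beta>\<close>, so the bound
  reproduces itself when \<open>E\<close> is first enlarged by \<open>V (Suc k)\<close> and then by \<open>B k\<close>.\<close>
lemma uniform_sweep_bound:
  assumes r: "0 \<le> r" "r < 1" and C: "0 < C"
    and expansion: "\<And>E. openin TX E \<Longrightarrow> E \<noteq> {} \<Longrightarrow> measure \<mu> E powr r \<le> C * measure \<mu> (sweep (B 0) E)"
  obtains c where "0 < c" "\<And>E. openin TX E \<Longrightarrow> E \<noteq> {} \<Longrightarrow> c \<le> measure \<mu> (sweep (V 0) E)"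
proof -
  \<comment> \<open>A single base for all constants: scale \<open>k\<close> costs at most
    \<open>D ^ (k + 1)\<close>, one factor for \<open>C\<close> and \<open>k\<close> for the
    translates.\<close>
  define D where "D = max 1 (max C (real M))"
  have D: "1 \<le> D" "C \<le> D" "real M \<le> D" "0 < D" unfolding D_def by auto
  \<comment> \<open>\<open>\<alpha> * k + \<beta>\<close> is the value of the series with terms
    \<open>(k + j + 1) * r ^ j\<close>, the total exponent of \<open>D\<close> collected from scale
    \<open>k\<close> on.\<close>
  define \<alpha> where "\<alpha> = 1 / (1 - r)"
  define \<beta> where "\<beta> = \<alpha> * \<alpha>"
  have "1 + r * \<alpha> = \<alpha>" using r unfolding \<alpha>_def by (simp add: field_simps)
  have "\<alpha> + r * \<beta> = \<beta>"
    using arg_cong[OF \<open>1 + r * \<alpha> = \<alpha>\<close>, of "\<lambda>x. x * \<alpha>"] unfolding \<beta>_def by (simp add: algebra_simps)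
  have exponent: "(real k + 1) + r * (\<alpha> * real (Suc k) + \<beta>) = \<alpha> * real k + \<beta>" for k
  proof -
    have "(real k + 1) + r * (\<alpha> * real (Suc k) + \<beta>) = (1 + r * \<alpha>) * (real k + 1) + r * \<beta>"
      by (simp add: algebra_simps)
    also have "\<dots> = \<alpha> * real k + (\<alpha> + r * \<beta>)"
      unfolding \<open>1 + r * \<alpha> = \<alpha>\<close> by (simp add: algebra_simps)
    finally show ?thesis unfolding \<open>\<alpha> + r * \<beta> = \<beta>\<close> .
  qed
  have step: "measure \<mu> E powr r \<le> D ^ (k + 1) * measure \<mu> (sweep (B k) E)"
    if E: "openin TX E" "E \<noteq> {}" for k E
  proof -
    obtain F where F: "finite F" "card F \<le> M ^ k" "F \<subseteq> carrier G" "B 0 \<subseteq> (\<Union>g\<in>F. l_coset G g (B k))"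
      using iterated_doubling[of k] by (elim exE conjE)
    have "measure \<mu> (sweep (B 0) E) \<le> card F * measure \<mu> (sweep (B k) E)"
      using F E(1) B_carrier by (intro measure_sweep_cover) auto
    also have "\<dots> \<le> D ^ k * measure \<mu> (sweep (B k) E)"
    proof (rule mult_right_mono)
      have "real (card F) \<le> real M ^ k" using F(2) by (metis of_nat_le_iff of_nat_power)
      also have "\<dots> \<le> D ^ k" using D by (intro power_mono) auto
      finally show "real (card F) \<le> D ^ k" .
    qed simp
    finally have "C * measure \<mu> (sweep (B 0) E) \<le> D * (D ^ k * measure \<mu> (sweep (B k) E))"
      using C D by (intro mult_mono) auto
    then show ?thesis using expansion[OF E] by (simp add: mult.assoc)
  qed
  \<comment> \<open>The constant does not depend on the number \<open>j\<close> of iterations, so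
    \<open>j\<close> can tend to infinity with \<open>E\<close> fixed. The scale \<open>k\<close>
    must vary in the induction, since the inner steps start at \<open>Suc k\<close>.\<close>
  have iterate: "D powr - (\<alpha> * real k + \<beta>) * measure \<mu> E powr (r ^ j) \<le> measure \<mu> (sweep (V k) E)"
    if "openin TX E" "E \<noteq> {}" for j k E
    using that
  proof (induction j arbitrary: k)
    case 0
    have "\<alpha> * real k + \<beta> \<ge> 0" using r unfolding \<alpha>_def \<beta>_def by simp
    then have "D powr - (\<alpha> * real k + \<beta>) \<le> 1" using D powr_mono[of "- (\<alpha> * real k + \<beta>)" 0 D] by simp
    then have "D powr - (\<alpha> * real k + \<beta>) * measure \<mu> E \<le> measure \<mu> E"
      using mult_right_mono[of _ 1 "measure \<mu> E"] by simp
    also have "\<dots> \<le> measure \<mu> (sweep (V k) E)"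
      using 0 V_carrier openin_subset[OF 0(1)]
      by (intro finite_measure_mono sweep_superset V_one openin_sets_\<mu> openin_sweep)
    finally show ?case using measure_open_pos[OF 0] by simp
  next
    case (Suc j)
    let ?E = "sweep (V (Suc k)) E"
    have EX: "E \<subseteq> topspace TX" using Suc.prems openin_subset by blast
    have op: "openin TX ?E" using V_carrier Suc.prems(1) by (rule openin_sweep)
    have ne: "?E \<noteq> {}" using sweep_superset[OF V_one EX, of "Suc k"] Suc.prems(2) by blast
    have "D powr - (\<alpha> * real k + \<beta>) * measure \<mu> E powr (r ^ Suc j)
        = D powr - (real k + 1) * (D powr - (\<alpha> * real (Suc k) + \<beta>) * measure \<mu> E powr (r ^ j)) powr r"
    proof -
      have "(D powr - (\<alpha> * real (Suc k) + \<beta>) * measure \<mu> E powr (r ^ j)) powr r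
          = D powr (- (\<alpha> * real (Suc k) + \<beta>) * r) * measure \<mu> E powr (r ^ Suc j)"
        by (simp add: powr_mult powr_powr mult.commute)
      moreover have "- (\<alpha> * real k + \<beta>) = - (real k + 1) + - (\<alpha> * real (Suc k) + \<beta>) * r"
        unfolding exponent[of k, symmetric] by (simp add: algebra_simps)
      ultimately show ?thesis by (simp only: powr_add mult.assoc)
    qed
    also have "\<dots> \<le> D powr - (real k + 1) * measure \<mu> ?E powr r"
      using Suc.IH[OF Suc.prems, of "Suc k"] r by (intro mult_left_mono powr_mono2) auto
    also have "\<dots> \<le> D powr - (real k + 1) * (D ^ (k + 1) * measure \<mu> (sweep (B k) ?E))"
      using step[OF op ne, of k] by (intro mult_left_mono) auto
    also have "\<dots> = measure \<mu> (sweep (B k) ?E)"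
    proof -
      have "D powr - (real k + 1) * D ^ (k + 1) = D powr - (real k + 1) * D powr (real k + 1)"
        using D powr_realpow[of D "k + 1"] by (simp add: add.commute)
      also have "\<dots> = 1" using D by (simp add: powr_add[symmetric])
      finally show ?thesis by (simp only: mult.assoc[symmetric] mult_1)
    qed
    also have "\<dots> \<le> measure \<mu> (sweep (V k) E)"
      using sweep_mono[OF B_mult_V[of k] order_refl, of E] V_carrier Suc.prems(1)
      by (intro finite_measure_mono openin_sets_\<mu> openin_sweep)
        (simp_all add: sweep_sweep[OF B_carrier V_carrier EX])
    finally show ?case .
  qed
  show thesis
  proof (rule that)
    show "0 < D powr - \<beta>" using D by simp
    fix E assume E: "openin TX E" "E \<noteq> {}"
    have "(\<lambda>j. D powr - \<beta> * measure \<mu> E powr (r ^ j)) \<longlonglongrightarrow> D powr - \<beta> * measure \<mu> E powr 0"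
      using r measure_open_pos[OF E] by (intro tendsto_intros LIMSEQ_power_zero) auto
    moreover have "D powr - \<beta> * measure \<mu> E powr (r ^ j) \<le> measure \<mu> (sweep (V 0) E)" for j
      using iterate[OF E, of 0 j] by simp
    ultimately have "D powr - \<beta> * measure \<mu> E powr 0 \<le> measure \<mu> (sweep (V 0) E)"
      by (intro LIMSEQ_le_const2) auto
    then show "D powr - \<beta> \<le> measure \<mu> (sweep (V 0) E)" using measure_open_pos[OF E] by simp
  qed
qed

theorem homogeneous_if_qualitative_sobolev:
  assumes "connected_space TG" and conn: "connected_space TX" and haus: "Hausdorff_space TX"
    and sob: "qualitative_sobolev G TG act \<mu>"
  shows "\<exists>H. subgroup H G \<and> closedin TG H \<and> compact_space (coset_topology G TG H) \<and>
             coset_space_iso G TG TX act H"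
proof -
  obtain r C where r: "0 \<le> r" "r < 1" "0 < C"
    and expansion: "\<And>E. openin TX E \<Longrightarrow> E \<noteq> {} \<Longrightarrow> measure \<mu> E powr r \<le> C * measure \<mu> (sweep (B 0) E)"
    by (rule sobolev_expansion[OF second_countable_if_connected[OF assms(1)] sob B_open[of 0] B_one[of 0]])
      (rule that)
  obtain c where c: "0 < c" "\<And>E. openin TX E \<Longrightarrow> E \<noteq> {} \<Longrightarrow> c \<le> measure \<mu> (sweep (V 0) E)"
    by (rule uniform_sweep_bound[OF r]) (rule expansion, assumption, assumption, rule that)
  have bound: "card F \<le> nat \<lfloor>1 / c\<rfloor>"
    if "finite F" "F \<subseteq> topspace TX"
      "pairwise (\<lambda>x y. disjnt ((\<lambda>g. act g x) ` K) ((\<lambda>g. act g y) ` K)) F" for F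
  proof -
    have "real (card F) * c \<le> 1"
      using disjoint_orbit_pieces_bound[OF haus K_compact V_subset_K prob openin_sets_\<mu> c(2) that] .
    then have "real (card F) \<le> 1 / c" using c(1) by (simp add: field_simps)
    then show ?thesis by (simp add: le_nat_floor)
  qed
  have "K \<noteq> {}" using V_one V_subset_K by blast
  obtain F where F: "finite F" "F \<subseteq> topspace TX"
    "topspace TX = (\<Union>y\<in>F. (\<lambda>g. act g y) ` {inv g \<otimes> h | g h. g \<in> K \<and> h \<in> K})"
    using finite_cover_by_orbit_pieces[OF K_compact \<open>K \<noteq> {}\<close> bound] .
  obtain x0 where x0: "x0 \<in> topspace TX" using not_empty unfolding space_\<mu> by blast
  obtain L where L: "compactin TG L" "topspace TX = (\<lambda>g. act g x0) ` L"
    using transitive_and_compact[OF haus conn F(1,2) compactin_quotients[OF K_compact] F(3) x0] .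
  have LG: "L \<subseteq> carrier G" using compactin_subset_topspace[OF L(1)] by simp
  have trans: "topspace TX = (\<lambda>g. act g x0) ` carrier G"
    using L(2) LG act_closed[OF _ x0] by (intro subset_antisym subsetI) auto
  have lc: "locally_compact_space TG"
    using locally_compact_if_compact_neighbourhood_one[OF V_open V_one V_subset_K K_compact] .
  have iso: "coset_space_iso G TG TX act (stabilizer x0)"
    using x0 trans orbit_map_open[OF haus Hausdorff lc x0 L] by (rule coset_space_iso_stabilizer)
  \<comment> \<open>Cocompactness: \<open>X\<close> is the image of the compact set
    \<open>L\<close>, and the homeomorphism carries compactness over to the coset space.\<close>
  have "compact_space TX"
    using compactin_orbit_piece[OF L(1) x0] L(2) unfolding compact_space_def by simp
  moreover have "TX homeomorphic_space coset_topology G TG (stabilizer x0)"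
    using iso unfolding coset_space_iso_def by (auto intro: homeomorphic_map_imp_homeomorphic_space)
  ultimately have "compact_space (coset_topology G TG (stabilizer x0))"
    using homeomorphic_compact_space by blast
  then show ?thesis
    using iso subgroup_stabilizer[OF x0] closedin_stabilizer[OF haus x0] by blast
qed

end

section \<open>Lie groups\<close>

text \<open>By continuity, each partial derivative near \<open>x\<close> exceeds its norm at
  \<open>x\<close> by less than \<open>1\<close>. Summing over the basis bounds the operator norm of
  the derivative, and the mean value inequality applies because balls are convex.\<close>

lemma smooth_on_locally_Lipschitz:
  fixes f :: "'a::euclidean_space \<Rightarrow> 'b::euclidean_space"
  assumes f: "smooth_on S f" and x: "x \<in> S"
  shows "\<exists>d L. 0 < d \<and> 0 \<le> L \<and> ball x d \<subseteq> S \<and>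
    (\<forall>y\<in>ball x d. \<forall>z\<in>ball x d. norm (f y - f z) \<le> L * norm (y - z))"
proof -
  have S: "open S" and diff: "\<And>vs. vs \<in> lists Basis \<Longrightarrow> iter_dderiv vs f differentiable_on S"
    using f unfolding smooth_on_def by auto
  let ?D = "\<lambda>y. frechet_derivative f (at y)"
  have deriv: "(f has_derivative ?D y) (at y)" if "y \<in> S" for y
    using diff[of "[]"] S that frechet_derivative_works
    by (auto simp: differentiable_on_def at_within_open[OF _ S])
  have cont: "isCont (\<lambda>y. ?D y b) x" if "b \<in> Basis" for b
  proof -
    have "(\<lambda>y. ?D y b) differentiable_on S" using diff[of "[b]"] that by simp
    then have "continuous_on S (\<lambda>y. ?D y b)" by (rule differentiable_imp_continuous_on)
    then show ?thesis using S x continuous_on_eq_continuous_at by blast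
  qed
  have "\<forall>\<^sub>F y in nhds x. norm (?D y b) < norm (?D x b) + 1" if "b \<in> Basis" for b
  proof -
    have "((\<lambda>y. ?D y b) \<longlongrightarrow> ?D x b) (nhds x)"
      using cont[OF that] unfolding isCont_def by (rule tendsto_at_iff_tendsto_nhds[THEN iffD1])
    then have "((\<lambda>y. norm (?D y b)) \<longlongrightarrow> norm (?D x b)) (nhds x)" by (rule tendsto_norm)
    then show ?thesis by (rule order_tendstoD) simp
  qed
  then have "\<forall>\<^sub>F y in nhds x. \<forall>b\<in>Basis. norm (?D y b) < norm (?D x b) + 1"
    by (intro eventually_ball_finite) auto
  moreover have "\<forall>\<^sub>F y in nhds x. y \<in> S" using S x by (rule eventually_nhds_in_open)
  ultimately have "\<forall>\<^sub>F y in nhds x. y \<in> S \<and> (\<forall>b\<in>Basis. norm (?D y b) < norm (?D x b) + 1)"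
    by eventually_elim simp
  then obtain d where d: "0 < d"
    and near: "\<forall>y. dist y x < d \<longrightarrow> y \<in> S \<and> (\<forall>b\<in>Basis. norm (?D y b) < norm (?D x b) + 1)"
    unfolding eventually_nhds_metric by blast
  define L where "L = (\<Sum>b\<in>Basis. norm (?D x b) + 1)"
  have sub: "ball x d \<subseteq> S" using near by (auto simp: dist_commute)
  have onorm: "onorm (?D y) \<le> L" if y: "y \<in> ball x d" for y
  proof (rule onorm_le)
    fix v :: 'a
    have lin: "linear (?D y)" using deriv y sub has_derivative_linear by blast
    have "?D y v = ?D y (\<Sum>b\<in>Basis. (v \<bullet> b) *\<^sub>R b)" by (simp add: euclidean_representation)
    also have "\<dots> = (\<Sum>b\<in>Basis. (v \<bullet> b) *\<^sub>R ?D y b)"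
      by (simp add: linear_sum[OF lin] linear_scale[OF lin])
    finally have eq: "?D y v = (\<Sum>b\<in>Basis. (v \<bullet> b) *\<^sub>R ?D y b)" .
    have "norm (?D y v) \<le> (\<Sum>b\<in>Basis. norm ((v \<bullet> b) *\<^sub>R ?D y b))"
      unfolding eq by (rule norm_sum)
    also have "\<dots> \<le> (\<Sum>b\<in>Basis. norm v * (norm (?D x b) + 1))"
    proof (rule sum_mono)
      fix b :: 'a assume b: "b \<in> Basis"
      have "norm (?D y b) \<le> norm (?D x b) + 1" using near y b by (auto simp: dist_commute less_imp_le)
      then show "norm ((v \<bullet> b) *\<^sub>R ?D y b) \<le> norm v * (norm (?D x b) + 1)"
        using Basis_le_norm[OF b, of v] by (simp add: mult_mono)
    qed
    finally show "norm (?D y v) \<le> L * norm v" by (simp add: L_def sum_distrib_left mult.commute)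
  qed
  show ?thesis
  proof (rule exI[of _ d], rule exI[of _ L], intro conjI ballI)
    show "0 \<le> L" unfolding L_def by (intro sum_nonneg) (simp add: add_nonneg_nonneg)
    fix y z assume yz: "y \<in> ball x d" "z \<in> ball x d"
    show "norm (f y - f z) \<le> L * norm (y - z)"
    proof (rule differentiable_bound[OF convex_ball _ onorm yz])
      fix w assume "w \<in> ball x d"
      then show "(f has_derivative ?D w) (at w within ball x d)"
        using deriv sub has_derivative_at_withinI by blast
    qed
  qed (use d sub in auto)
qed

text \<open>Of the smooth structure only the two Lipschitz estimates \<open>mult\<close> and \<open>divide\<close> are needed.\<close>
locale local_coordinates = topological_group +
  fixes \<phi> :: "'g \<Rightarrow> 'n::euclidean_space" and \<psi> :: "'n \<Rightarrow> 'g" and U :: "'g set" and e :: 'n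
    and \<delta> L :: real
  assumes Hausdorff: "Hausdorff_space TG"
    and U: "U \<subseteq> carrier G" and \<delta>: "0 < \<delta>" and L: "1 \<le> L"
    and \<psi>_e: "\<psi> e = \<one>"
    and \<psi>_\<phi>: "x \<in> U \<Longrightarrow> \<psi> (\<phi> x) = x"
    and \<psi>_U: "a \<in> ball e \<delta> \<Longrightarrow> \<psi> a \<in> U"
    and open_image: "T \<subseteq> ball e \<delta> \<Longrightarrow> open T \<Longrightarrow> openin TG (\<psi> ` T)"
    and compact_image: "T \<subseteq> ball e \<delta> \<Longrightarrow> compact T \<Longrightarrow> compactin TG (\<psi> ` T)"
    and base: "openin TG W \<Longrightarrow> \<one> \<in> W \<Longrightarrow> \<exists>\<eta>>0. \<psi> ` ball e \<eta> \<subseteq> W"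
    and mult: "a \<in> ball e \<delta> \<Longrightarrow> b \<in> ball e \<delta> \<Longrightarrow>
      \<psi> a \<otimes> \<psi> b \<in> U \<and> norm (\<phi> (\<psi> a \<otimes> \<psi> b) - b) \<le> L * norm (a - e)"
    and divide: "a \<in> ball e \<delta> \<Longrightarrow> b \<in> ball e \<delta> \<Longrightarrow>
      inv (\<psi> a) \<otimes> \<psi> b \<in> U \<and> norm (\<phi> (inv (\<psi> a) \<otimes> \<psi> b) - e) \<le> L * norm (a - b)"
begin

lemma in_\<psi>_imageI:
  assumes "x \<in> U" "norm (\<phi> x - e) < s"
  shows "x \<in> \<psi> ` ball e s"
  using assms \<psi>_\<phi>[OF assms(1)] by (intro image_eqI[of x \<psi> "\<phi> x"]) (auto simp: dist_norm norm_minus_commute)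

text \<open>The radius \<open>2 * L * \<epsilon> k\<close> of \<open>V k\<close> solves the
  recursion of \<open>B_mult_V\<close>: by \<open>mult\<close>, a factor from \<open>B k\<close>
  moves a point by at most \<open>L * \<epsilon> k\<close>, and the radius of
  \<open>V (Suc k)\<close> is again \<open>L * \<epsilon> k\<close>.\<close>

lemma doubling_group: "\<exists>B V K M. doubling_group G TG B V K M"
proof -
  \<comment> \<open>The factor \<open>4 * L\<close> gives \<open>V 0\<close> the radius
    \<open>\<delta> / 2\<close>, so that its closed ball still lies in the coordinate ball.\<close>
  define \<epsilon> where "\<epsilon> k = \<delta> / (4 * L) / 2 ^ k" for k :: nat
  have \<epsilon>_pos: "0 < \<epsilon> k" for k using \<delta> L unfolding \<epsilon>_def by simp
  have \<epsilon>_Suc: "\<epsilon> (Suc k) = \<epsilon> k / 2" for k unfolding \<epsilon>_def by simp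
  have L\<epsilon>: "2 * L * \<epsilon> k \<le> \<delta> / 2" for k
  proof -
    have "2 * L * \<epsilon> k = \<delta> / 2 / 2 ^ k" using L unfolding \<epsilon>_def by simp
    also have "\<dots> \<le> \<delta> / 2" using \<delta> by (simp add: field_simps)
    finally show ?thesis .
  qed
  have \<epsilon>_le: "\<epsilon> k \<le> 2 * L * \<epsilon> k" for k using L \<epsilon>_pos[of k] by simp
  have \<epsilon>_less: "\<epsilon> k < \<delta>" "2 * L * \<epsilon> k < \<delta>" for k
    using \<epsilon>_le[of k] L\<epsilon>[of k] \<delta> by linarith+
  \<comment> \<open>Scaled by \<open>\<epsilon> k\<close>, these balls have radius
    \<open>\<epsilon> (Suc k) / L\<close>, which \<open>divide\<close> turns into membership of the
    quotient in \<open>B (Suc k)\<close>. The same finite set \<open>T\<close> serves every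
    \<open>k\<close>, whence a scale-free \<open>M\<close>.\<close>
  have cover: "cball (0::'n) 1 \<subseteq> (\<Union>t\<in>cball 0 1. ball t (1 / (2 * L)))" using L by force
  obtain T where T: "T \<subseteq> cball 0 1" "finite T" "cball (0::'n) 1 \<subseteq> (\<Union>t\<in>T. ball t (1 / (2 * L)))"
    by (rule compactE_image[OF compact_cball open_ball cover])
  let ?B = "\<lambda>k. \<psi> ` ball e (\<epsilon> k)" and ?V = "\<lambda>k. \<psi> ` ball e (2 * L * \<epsilon> k)"
  have "doubling_group G TG ?B ?V (\<psi> ` cball e (\<delta> / 2)) (card T)"
  proof unfold_locales
    fix k
    show "Hausdorff_space TG" by (rule Hausdorff)
    show "openin TG (?B k)" "openin TG (?V k)" using \<epsilon>_less[of k] by (intro open_image subset_ball open_ball; simp)+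
    show "\<one> \<in> ?B k" using \<epsilon>_pos[of k] \<psi>_e by (intro image_eqI[of _ _ e]) auto
    show "\<one> \<in> ?V k" using \<epsilon>_pos[of k] \<epsilon>_le[of k] \<psi>_e by (intro image_eqI[of _ _ e]) auto
    show "?B k <#> ?V (Suc k) \<subseteq> ?V k"
    proof
      fix x assume "x \<in> ?B k <#> ?V (Suc k)"
      then obtain a b where a: "a \<in> ball e (\<epsilon> k)" and b: "b \<in> ball e (2 * L * \<epsilon> (Suc k))"
        and x: "x = \<psi> a \<otimes> \<psi> b" unfolding set_mult_def by blast
      have ab: "a \<in> ball e \<delta>" "b \<in> ball e \<delta>"
        using a b \<epsilon>_less(1)[of k] \<epsilon>_less(2)[of "Suc k"] by auto
      have "norm (\<phi> x - b) \<le> L * norm (a - e)" using mult[OF ab] x by simp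
      also have "\<dots> < L * \<epsilon> k" using a L by (simp add: dist_norm norm_minus_commute)
      finally have "norm (\<phi> x - b) < L * \<epsilon> k" .
      moreover have "norm (b - e) < L * \<epsilon> k" using b by (simp add: \<epsilon>_Suc dist_norm norm_minus_commute)
      moreover have "norm (\<phi> x - e) \<le> norm (\<phi> x - b) + norm (b - e)"
        using norm_triangle_ineq[of "\<phi> x - b" "b - e"] by simp
      ultimately have "norm (\<phi> x - e) < 2 * L * \<epsilon> k" by linarith
      then show "x \<in> ?V k" using mult[OF ab] x by (intro in_\<psi>_imageI) auto
    qed
    show "?V 0 \<subseteq> \<psi> ` cball e (\<delta> / 2)" using L\<epsilon>[of 0] by (intro image_mono) auto
    show "compactin TG (\<psi> ` cball e (\<delta> / 2))" using \<delta> by (intro compact_image) auto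
    show "\<exists>F. finite F \<and> card F \<le> card T \<and> F \<subseteq> carrier G \<and> ?B k \<subseteq> (\<Union>g\<in>F. l_coset G g (?B (Suc k)))"
    proof (intro exI conjI)
      let ?F = "(\<lambda>t. \<psi> (e + \<epsilon> k *\<^sub>R t)) ` T"
      have center: "e + \<epsilon> k *\<^sub>R t \<in> ball e \<delta>" if "t \<in> T" for t
      proof -
        have "norm t \<le> 1" using that T(1) by auto
        then have "\<epsilon> k * norm t \<le> \<epsilon> k * 1" using \<epsilon>_pos[of k] by (intro mult_left_mono) auto
        then have "\<epsilon> k * norm t < \<delta>" using \<epsilon>_less(1)[of k] by linarith
        then show ?thesis using \<epsilon>_pos[of k] by (simp add: dist_norm)
      qed
      show "finite ?F" "card ?F \<le> card T" using T(2) card_image_le by auto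
      show "?F \<subseteq> carrier G" using center \<psi>_U U by blast
      show "?B k \<subseteq> (\<Union>g\<in>?F. l_coset G g (?B (Suc k)))"
      proof
        fix x assume "x \<in> ?B k"
        then obtain a where a: "a \<in> ball e (\<epsilon> k)" "x = \<psi> a" by blast
        have "norm (a - e) < \<epsilon> k" using a by (simp add: dist_norm norm_minus_commute)
        then have "(1 / \<epsilon> k) *\<^sub>R (a - e) \<in> cball 0 1"
          using \<epsilon>_pos[of k] by (simp add: pos_divide_le_eq)
        then obtain t where "t \<in> T" "(1 / \<epsilon> k) *\<^sub>R (a - e) \<in> ball t (1 / (2 * L))" using T(3) by blast
        then have t: "t \<in> T" "norm ((1 / \<epsilon> k) *\<^sub>R (a - e) - t) < 1 / (2 * L)"
          by (simp_all only: mem_ball dist_norm norm_minus_commute[of t])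
        define b where "b = e + \<epsilon> k *\<^sub>R t"
        have b: "b \<in> ball e \<delta>" unfolding b_def using center t by blast
        have aD: "a \<in> ball e \<delta>" using a \<epsilon>_less(1)[of k] by auto
        let ?y = "inv (\<psi> b) \<otimes> \<psi> a"
        have "a - b = \<epsilon> k *\<^sub>R ((1 / \<epsilon> k) *\<^sub>R (a - e) - t)"
          using \<epsilon>_pos[of k] unfolding b_def by (simp add: algebra_simps)
        then have "norm (a - b) = \<epsilon> k * norm ((1 / \<epsilon> k) *\<^sub>R (a - e) - t)" using \<epsilon>_pos[of k] by simp
        also have "\<dots> < \<epsilon> k * (1 / (2 * L))" using t(2) \<epsilon>_pos[of k] by (intro mult_strict_left_mono)
        finally have "norm (a - b) < \<epsilon> k * (1 / (2 * L))" .
        then have "L * norm (b - a) < L * (\<epsilon> k * (1 / (2 * L)))"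
          using L unfolding norm_minus_commute[of b a] by (intro mult_strict_left_mono) auto
        also have "\<dots> = \<epsilon> (Suc k)" using L by (simp add: \<epsilon>_Suc)
        finally have "norm (\<phi> ?y - e) < \<epsilon> (Suc k)" using divide[OF b aD] by linarith
        then have "?y \<in> ?B (Suc k)" using divide[OF b aD] by (intro in_\<psi>_imageI) auto
        moreover have "x = \<psi> b \<otimes> ?y"
          using a(2) subsetD[OF U \<psi>_U[OF b]] subsetD[OF U \<psi>_U[OF aD]] by (simp add: m_assoc[symmetric])
        ultimately have "x \<in> l_coset G (\<psi> b) (?B (Suc k))" unfolding l_coset_def by blast
        then show "x \<in> (\<Union>g\<in>?F. l_coset G g (?B (Suc k)))" using t(1) unfolding b_def by blast
      qed
    qed
  next
    fix W assume "openin TG W" "\<one> \<in> W"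
    then obtain \<eta> where \<eta>: "0 < \<eta>" "\<psi> ` ball e \<eta> \<subseteq> W" using base by blast
    obtain k where "(1 / 2) ^ k < \<eta> / (\<delta> / (4 * L))"
      using real_arch_pow_inv[of "\<eta> / (\<delta> / (4 * L))" "1 / 2"] \<eta>(1) \<delta> L by auto
    then have "\<epsilon> k < \<eta>" using \<delta> L unfolding \<epsilon>_def by (simp add: field_simps power_divide)
    then have "?B k \<subseteq> \<psi> ` ball e \<eta>" by (intro image_mono) auto
    then show "\<exists>k. ?B k \<subseteq> W" using \<eta>(2) by blast
  qed
  then show ?thesis by blast
qed

end

text \<open>Both estimates come from one Lipschitz bound for multiplication in coordinates near
  \<open>(e, e)\<close>: \<open>mult\<close> compares the product with
  \<open>\<one> \<otimes> \<psi> b\<close>, and \<open>divide\<close> compares the quotient with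
  \<open>inv (\<psi> a) \<otimes> \<psi> a\<close>.\<close>

lemma (in topological_group) local_coordinates_if_smooth:
  fixes A :: "('g set \<times> ('g \<Rightarrow> 'n::euclidean_space)) set"
  assumes haus: "Hausdorff_space TG" and atlas: "smooth_atlas TG A"
    and smooth: "smooth_map_atlas (prod_topology TG TG) (prod_atlas A A) TG A (\<lambda>(x, y). x \<otimes> y)"
  shows "\<exists>(\<phi> :: 'g \<Rightarrow> 'n) \<psi> U e \<delta> L. local_coordinates G TG \<phi> \<psi> U e \<delta> L"
proof -
  have "\<one> \<in> (\<Union>(U, \<phi>)\<in>A. U)" using atlas unfolding smooth_atlas_def by simp
  then obtain U \<phi> where chart: "(U, \<phi>) \<in> A" and one_U: "\<one> \<in> U" by blast
  have ch: "chart_on TG U \<phi>" using atlas chart unfolding smooth_atlas_def by blast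
  have U_open: "openin TG U" and img: "open (\<phi> ` U)"
    and hom: "homeomorphic_map (subtopology TG U) (top_of_set (\<phi> ` U)) \<phi>"
    using ch unfolding chart_on_def by auto
  have U: "U \<subseteq> carrier G" using U_open by (rule openin_subset_carrier)
  obtain \<psi> where maps: "homeomorphic_maps (subtopology TG U) (top_of_set (\<phi> ` U)) \<phi> \<psi>"
    using hom unfolding homeomorphic_map_maps by blast
  have \<psi>_\<phi>: "\<psi> (\<phi> x) = x" if "x \<in> U" for x
    using maps that U unfolding homeomorphic_maps_def by auto
  have \<phi>_\<psi>: "\<phi> (\<psi> a) = a" "\<psi> a \<in> U" if "a \<in> \<phi> ` U" for a
    using that \<psi>_\<phi> by auto
  have inj: "inj_on \<phi> U" using \<psi>_\<phi> by (rule inj_on_inverseI)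
  have cont_\<phi>: "continuous_map (subtopology TG U) (top_of_set (\<phi> ` U)) \<phi>"
    and cont_\<psi>: "continuous_map (top_of_set (\<phi> ` U)) (subtopology TG U) \<psi>"
    using maps unfolding homeomorphic_maps_def by auto
  have open_image: "openin TG (\<psi> ` T)" if "T \<subseteq> \<phi> ` U" "open T" for T
  proof -
    have "openin (top_of_set (\<phi> ` U)) T" using that by (simp add: openin_open_eq img)
    then have "openin (subtopology TG U) {x \<in> topspace (subtopology TG U). \<phi> x \<in> T}"
      by (rule openin_continuous_map_preimage[OF cont_\<phi>])
    moreover have "{x \<in> topspace (subtopology TG U). \<phi> x \<in> T} = \<psi> ` T"
    proof (intro subset_antisym subsetI)
      fix x assume x: "x \<in> {x \<in> topspace (subtopology TG U). \<phi> x \<in> T}"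
      then have "\<psi> (\<phi> x) = x" using \<psi>_\<phi>[of x] by simp
      then show "x \<in> \<psi> ` T" using x by force
    next
      fix x assume "x \<in> \<psi> ` T"
      then obtain a where a: "a \<in> T" "x = \<psi> a" by blast
      then have "x \<in> U" "\<phi> x = a" using that(1) \<phi>_\<psi>[of a] by auto
      then show "x \<in> {x \<in> topspace (subtopology TG U). \<phi> x \<in> T}" using a U by auto
    qed
    ultimately have "openin (subtopology TG U) (\<psi> ` T)" by simp
    then show ?thesis using U_open by (rule openin_trans_full)
  qed
  have compact_image: "compactin TG (\<psi> ` T)" if "T \<subseteq> \<phi> ` U" "compact T" for T
  proof -
    have "compactin (top_of_set (\<phi> ` U)) T" using that by (simp add: compactin_subtopology)
    then have "compactin (subtopology TG U) (\<psi> ` T)" using cont_\<psi> by (rule image_compactin)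
    then show ?thesis by (simp add: compactin_subtopology)
  qed
  define e where "e = \<phi> \<one>"
  have e: "e \<in> \<phi> ` U" "\<psi> e = \<one>" unfolding e_def using one_U \<psi>_\<phi> by auto
  have base: "\<exists>\<eta>>0. \<psi> ` ball e \<eta> \<subseteq> W" if W: "openin TG W" "\<one> \<in> W" for W
  proof -
    have "openin (subtopology TG U) (U \<inter> W)" using W(1) by (rule openin_subtopology_Int2)
    then have "openin (top_of_set (\<phi> ` U)) {a \<in> topspace (top_of_set (\<phi> ` U)). \<psi> a \<in> U \<inter> W}"
      by (rule openin_continuous_map_preimage[OF cont_\<psi>])
    then have "open {a \<in> \<phi> ` U. \<psi> a \<in> U \<inter> W}" using img by (simp add: openin_open_eq)
    moreover have "e \<in> {a \<in> \<phi> ` U. \<psi> a \<in> U \<inter> W}" using e one_U W(2) by simp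
    ultimately obtain \<eta> where "0 < \<eta>" "ball e \<eta> \<subseteq> {a \<in> \<phi> ` U. \<psi> a \<in> U \<inter> W}"
      using open_contains_ball by blast
    then show ?thesis by blast
  qed
  let ?\<Phi> = "\<lambda>(x, y). (\<phi> x, \<phi> y)"
  let ?m = "\<lambda>(x, y). x \<otimes> y"
  let ?S = "?\<Phi> ` ((U \<times> U) \<inter> ?m -` U)"
  let ?f = "\<phi> \<circ> ?m \<circ> inv_into (U \<times> U) ?\<Phi>"
  have "(U \<times> U, ?\<Phi>) \<in> prod_atlas A A" using chart unfolding prod_atlas_def by blast
  then have "smooth_on ?S ?f" using smooth chart unfolding smooth_map_atlas_def by blast
  moreover have "(e, e) \<in> ?S" unfolding e_def using one_U by (intro image_eqI[of _ _ "(\<one>, \<one>)"]) auto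
  ultimately have "\<exists>d L. 0 < d \<and> 0 \<le> L \<and> ball (e, e) d \<subseteq> ?S \<and>
      (\<forall>y\<in>ball (e, e) d. \<forall>z\<in>ball (e, e) d. norm (?f y - ?f z) \<le> L * norm (y - z))"
    by (rule smooth_on_locally_Lipschitz)
  then obtain d L0 where d: "0 < d" "0 \<le> L0" "ball (e, e) d \<subseteq> ?S"
    and lip: "\<forall>y\<in>ball (e, e) d. \<forall>z\<in>ball (e, e) d. norm (?f y - ?f z) \<le> L0 * norm (y - z)"
    by (elim exE conjE)
  have pair: "(a, b) \<in> ball (e, e) d" if "a \<in> ball e (d / 2)" "b \<in> ball e (d / 2)" for a b
  proof -
    have "dist (e, e) (a, b) \<le> dist e a + dist e b"
      unfolding dist_Pair_Pair by (rule sqrt_sum_squares_le_sum) auto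
    then show ?thesis using that by simp
  qed
  have inj2: "inj_on ?\<Phi> (U \<times> U)" using inj by (auto simp: inj_on_def)
  \<comment> \<open>The smooth structure inverts the product chart by \<open>inv_into\<close>;
    injectivity of the chart identifies that inverse with \<open>\<psi>\<close> in each
    variable.\<close>
  have coords: "a \<in> \<phi> ` U \<and> b \<in> \<phi> ` U \<and> \<psi> a \<otimes> \<psi> b \<in> U \<and> ?f (a, b) = \<phi> (\<psi> a \<otimes> \<psi> b)"
    if ab: "a \<in> ball e (d / 2)" "b \<in> ball e (d / 2)" for a b
  proof -
    obtain z where z: "z \<in> (U \<times> U) \<inter> ?m -` U" "(a, b) = ?\<Phi> z"
      using pair[OF ab] d(3) by blast
    obtain x y where xy: "z = (x, y)" by (cases z)
    then have *: "x \<in> U" "y \<in> U" "x \<otimes> y \<in> U" "a = \<phi> x" "b = \<phi> y" using z by auto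
    have "inv_into (U \<times> U) ?\<Phi> (?\<Phi> z) = z" using z(1) by (intro inv_into_f_f[OF inj2]) blast
    then have "?f (a, b) = \<phi> (x \<otimes> y)" using z(2) xy by simp
    then show ?thesis using * \<psi>_\<phi> by auto
  qed
  have lip_mult: "norm (\<phi> (\<psi> a \<otimes> \<psi> b) - \<phi> (\<psi> a' \<otimes> \<psi> b')) \<le> L0 * norm ((a, b) - (a', b'))"
    if "a \<in> ball e (d / 2)" "b \<in> ball e (d / 2)" "a' \<in> ball e (d / 2)" "b' \<in> ball e (d / 2)" for a b a' b'
    using lip[rule_format, OF pair pair, of a b a' b'] that coords[of a b] coords[of a' b'] by simp
  have e_ball: "e \<in> ball e (d / 2)" using d by simp
  have sub: "ball e (d / 2) \<subseteq> \<phi> ` U" using coords[OF _ e_ball] by blast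
  \<comment> \<open>Continuity of inversion shrinks the ball until inverses also have coordinates
    where the Lipschitz bound holds.\<close>
  have "openin TG {x \<in> carrier G. inv x \<in> \<psi> ` ball e (d / 2)}"
    using sub by (intro openin_vimage continuous_inv open_image) auto
  moreover have "\<one> \<in> {x \<in> carrier G. inv x \<in> \<psi> ` ball e (d / 2)}"
    using e(2) e_ball by (auto intro!: image_eqI[of _ _ e])
  ultimately obtain \<eta> where \<eta>: "0 < \<eta>" "\<psi> ` ball e \<eta> \<subseteq> {x \<in> carrier G. inv x \<in> \<psi> ` ball e (d / 2)}"
    using base by blast
  define \<delta> where "\<delta> = min (d / 2) \<eta>"
  have \<delta>: "0 < \<delta>" "ball e \<delta> \<subseteq> ball e (d / 2)" "ball e \<delta> \<subseteq> ball e \<eta>"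
    using d \<eta>(1) unfolding \<delta>_def by auto
  \<comment> \<open>\<open>L0\<close> may be less than \<open>1\<close>; adding \<open>1\<close>
    meets the requirement \<open>1 \<le> L\<close>.\<close>
  have "local_coordinates G TG \<phi> \<psi> U e \<delta> (L0 + 1)"
  proof unfold_locales
    show "Hausdorff_space TG" "U \<subseteq> carrier G" "0 < \<delta>" "1 \<le> L0 + 1" "\<psi> e = \<one>"
      using haus U \<delta> d e by auto
    show "\<psi> (\<phi> x) = x" if "x \<in> U" for x using that by (rule \<psi>_\<phi>)
    show "\<psi> a \<in> U" if "a \<in> ball e \<delta>" for a using that \<delta> sub \<phi>_\<psi>(2) by blast
    show "openin TG (\<psi> ` T)" if "T \<subseteq> ball e \<delta>" "open T" for T
      using that \<delta> sub by (intro open_image) auto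
    show "compactin TG (\<psi> ` T)" if "T \<subseteq> ball e \<delta>" "compact T" for T
      using that \<delta> sub by (intro compact_image) auto
    show "\<exists>\<eta>>0. \<psi> ` ball e \<eta> \<subseteq> W" if "openin TG W" "\<one> \<in> W" for W using that by (rule base)
  next
    fix a b assume "a \<in> ball e \<delta>" "b \<in> ball e \<delta>"
    then have a: "a \<in> ball e (d / 2)" "a \<in> ball e \<eta>" and b: "b \<in> ball e (d / 2)" using \<delta> by auto
    have aU: "a \<in> \<phi> ` U" and bU: "b \<in> \<phi> ` U" using a(1) b sub by blast+
    have aG: "\<psi> a \<in> carrier G" and bG: "\<psi> b \<in> carrier G"
      using \<phi>_\<psi>(2)[OF aU] \<phi>_\<psi>(2)[OF bU] U by blast+
    have "norm (\<phi> (\<psi> a \<otimes> \<psi> b) - \<phi> (\<psi> e \<otimes> \<psi> b)) \<le> L0 * norm ((a, b) - (e, b))"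
      using a(1) b e_ball by (intro lip_mult)
    then have "norm (\<phi> (\<psi> a \<otimes> \<psi> b) - b) \<le> L0 * norm (a - e)"
      using bG e(2) \<phi>_\<psi>(1)[OF bU] by (simp add: norm_Pair)
    also have "\<dots> \<le> (L0 + 1) * norm (a - e)" by (intro mult_right_mono) auto
    finally show "\<psi> a \<otimes> \<psi> b \<in> U \<and> norm (\<phi> (\<psi> a \<otimes> \<psi> b) - b) \<le> (L0 + 1) * norm (a - e)"
      using coords[OF a(1) b] by simp
    obtain a' where a': "a' \<in> ball e (d / 2)" "inv (\<psi> a) = \<psi> a'" using \<eta>(2) a(2) by blast
    have "norm (\<phi> (\<psi> a' \<otimes> \<psi> b) - \<phi> (\<psi> a' \<otimes> \<psi> a)) \<le> L0 * norm ((a', b) - (a', a))"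
      using a(1) b a'(1) by (intro lip_mult)
    then have "norm (\<phi> (inv (\<psi> a) \<otimes> \<psi> b) - e) \<le> L0 * norm (a - b)"
      using aG unfolding e_def a'(2)[symmetric] by (simp add: norm_Pair norm_minus_commute)
    also have "\<dots> \<le> (L0 + 1) * norm (a - b)" by (intro mult_right_mono) auto
    finally show "inv (\<psi> a) \<otimes> \<psi> b \<in> U \<and> norm (\<phi> (inv (\<psi> a) \<otimes> \<psi> b) - e) \<le> (L0 + 1) * norm (a - b)"
      using coords[OF a'(1) b] a'(2) by simp
  qed
  then show ?thesis by blast
qed

lemma lie_group_topological_group:
  assumes "lie_group G TG TYPE('n::euclidean_space)"
  shows "topological_group G TG"
  using assms unfolding lie_group_def topological_group_def topological_group_axioms_def by simp

lemma connected_lie_group_doubling: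
  fixes G :: "('g, 'z) monoid_scheme"
  assumes lie: "lie_group G TG TYPE('n::euclidean_space)" and conn: "connected_space TG"
  shows "\<exists>B V K M. doubling_group G TG B V K M"
proof -
  interpret topological_group G TG using lie by (rule lie_group_topological_group)
  have haus: "Hausdorff_space TG" using lie unfolding lie_group_def by simp
  show ?thesis
  proof (cases "\<forall>U. U \<subseteq> topspace TG \<longrightarrow> openin TG U")
    \<comment> \<open>No type of class \<open>euclidean_space\<close> has dimension
      \<open>0\<close>, hence the separate discrete case in \<open>lie_group\<close>; a connected
      discrete group is trivial.\<close>
    case True
    then have "openin TG {\<one>\<^bsub>G\<^esub>}" "closedin TG {\<one>\<^bsub>G\<^esub>}" unfolding closedin_def by auto
    then have carrier: "carrier G = {\<one>\<^bsub>G\<^esub>}" using conn unfolding connected_space_clopen_in by auto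
    have "doubling_group G TG (\<lambda>_. {\<one>\<^bsub>G\<^esub>}) (\<lambda>_. {\<one>\<^bsub>G\<^esub>}) {\<one>\<^bsub>G\<^esub>} 1"
    proof unfold_locales
      show "\<exists>F. finite F \<and> card F \<le> 1 \<and> F \<subseteq> carrier G \<and> {\<one>\<^bsub>G\<^esub>} \<subseteq> (\<Union>g\<in>F. l_coset G g {\<one>\<^bsub>G\<^esub>})" for k :: nat
        by (intro exI[of _ "{\<one>\<^bsub>G\<^esub>}"]) (auto simp: l_coset_def)
    qed (use haus \<open>openin TG {\<one>\<^bsub>G\<^esub>}\<close> in \<open>auto simp: set_mult_def\<close>)
    then show ?thesis by blast
  next
    case False
    then obtain A :: "('g set \<times> ('g \<Rightarrow> 'n)) set" where "smooth_atlas TG A"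
      "smooth_map_atlas (prod_topology TG TG) (prod_atlas A A) TG A (\<lambda>(x, y). x \<otimes>\<^bsub>G\<^esub> y)"
      using lie unfolding lie_group_def by blast
    then obtain \<phi> :: "'g \<Rightarrow> 'n" and \<psi> U e \<delta> L where "local_coordinates G TG \<phi> \<psi> U e \<delta> L"
      using local_coordinates_if_smooth[OF haus] by blast
    then show ?thesis by (rule local_coordinates.doubling_group)
  qed
qed

theorem theorem11p4:
  fixes G :: "('g, 'z) monoid_scheme" and TG :: "'g topology"
    and TX :: "'x topology" and act :: "'g \<Rightarrow> 'x \<Rightarrow> 'x" and \<mu> :: "'x measure"
  assumes "lie_group G TG TYPE('n::euclidean_space)"
    and "connected_space TG"
    and "g_space G TG TX act"
    and "connected_space TX" and "Hausdorff_space TX"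
    and "prob_space \<mu>" and "space \<mu> = topspace TX" and "sets \<mu> = sets (borel_of_top TX)"
    and "invariant_measure G act \<mu>"
    and "full_support TX \<mu>"
    and "qualitative_sobolev G TG act \<mu>"
  shows "\<exists>H. subgroup H G \<and> closedin TG H \<and> compact_space (coset_topology G TG H) \<and>
             coset_space_iso G TG TX act H"
proof -
  obtain B V K M where "doubling_group G TG B V K M"
    using connected_lie_group_doubling[OF assms(1,2)] by blast
  then interpret doubling_group G TG B V K M .
  interpret prob_space \<mu> by (rule assms(6))
  interpret doubling_action G TG B V K M TX act \<mu>
    using assms(3,7-10) by unfold_locales
  show ?thesis using assms(2,4,5,11) by (rule homogeneous_if_qualitative_sobolev)
qed

end
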